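(* Let $\lambda \in \Lambda \setminus \Lambda_{pq}$, where $(p,q)\in W(\mathbf{N}(\mathcal{X}))$, and let $V(\varphi,\rho)$ be an inverse integrating factor of $\frac{d\rho}{d\varphi} = \mathcal{F}(\varphi,\rho)$. Then the Poincaré map $\Pi$ of the monodromic singularity at the origin satisfies $$V(0, \Pi(\rho_0)) = V(0, \rho_0)\, \Pi'(\rho_0)$$ for all sufficiently small $\rho_0>0$.
   Context: Family. $\mathcal{X} = P(x,y;\lambda)\partial_x + Q(x,y;\lambda)\partial_y$ is a family of real planar vector fields, analytic in $(x,y)$ near the origin and depending analytically on parameters $\lambda \in \mathbb{R}^d$. $\Lambda \subset \mathbb{R}^d$ is the set of parameters for which the origin is a monodromic singularity: $P(0,0;\lambda)=Q(0,0;\lambda)=0$ and the local orbits turn around the origin. Newton diagram and weights. Write $P = \sum a_{ij} x^i y^{j-1}$, $Q = \sum b_{ij} x^{i-1} y^j$ with $(i,j) \in \mathbb{N}^2$; let $\mathrm{supp}(\mathcal{X}) = \{(i,j) : (a_{ij},b_{ij}) \ne (0,0)\}$. The boundary of the convex hull of $\bigcup_{(i,j)\in \mathrm{supp}(\mathcal{X})} \{(i,j)+\mathbb{R}_+^2\}$ contains a polygon; in the monodromic case the Newton diagram $\mathbf{N}(\mathcal{X})$ consists of the edges of this polygon. To each edge one associates weights $(p,q)\in\mathbb{N}^2$, $p,q$ coprime, where $q/p$ is the tangent of the angle between the edge and the ordinate axis (so $pi+qj$ is constant on the edge). $W(\mathbf{N}(\mathcal{X}))$ is the set of all these weights. Given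 $(p,q)\in W(\mathbf{N}(\mathcal{X}))$, expand $\mathcal{X} = \sum_{j\ge r}\mathcal{X}_j$ with $\mathcal{X}_j = P_{p+j}\partial_x + Q_{q+j}\partial_y$ $(p,q)$-quasihomogeneous of degree $j$ (i.e. $P_{p+j}(s^p x, s^q y)=s^{p+j}P_{p+j}(x,y)$, $Q_{q+j}(s^p x, s^q y)=s^{q+j}Q_{q+j}(x,y)$) and $\mathcal{X}_r\not\equiv 0$. Polar equation. The weighted polar blow-up $(x,y) = (\rho^p\cos\varphi, \rho^q\sin\varphi)$, after division by $\rho^r$ (time rescaling), transforms the system into $\dot\rho = R(\varphi,\rho)$, $\dot\varphi=\Theta(\varphi,\rho)$, analytic near $\rho=0$, with $R(\varphi,0)\equiv 0$. Put $\mathcal{F}=R/\Theta$. Let $C = \{(\varphi,\rho)\in \mathbb{S}^1\times\mathbb{R} : 0\le\rho\ll 1\}$, $\mathbb{S}^1=\mathbb{R}/(2\pi\mathbb{Z})$; $\Theta^{-1}(0) = \{(\varphi,\rho)\in C: \Theta(\varphi,\rho)=0\}$. Critical parameters: $\Lambda_{pq} = \{\lambda\in\Lambda : \Theta^{-1}(0)\setminus\{\rho=0\}\neq\emptyset\}$. Inverse integrating factor: a not locally null real function $V$ of class $C^1$ on $C\setminus(\Theta^{-1}(0)\cup\{\rho=0\})$ with $\frac{\partial V}{\partial\varphi} + \frac{\partial V}{\partial\rho}\mathcal{F} = \frac{\partial\mathcal{F}}{\partial\rho}V$ there. Poincaré map: $\Phi(\varphi;\rho_0)$ is the solution of $d\rho/d\varphi=\mathcal{F}(\varphi,\rho)$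 with $\Phi(0;\rho_0)=\rho_0>0$ small, and $\Pi(\rho_0) = \Phi(2\pi;\rho_0)$ (i.e. the section $\{(x,0): 0<x\ll1\}$ is parameterized by $x=\rho_0^p$). *)

theory Defs
  imports "HOL-Analysis.Analysis"
begin

section \<open>Analytic families of planar vector fields\<close>

text \<open>Multi-indices are functions on the canonical basis; the expansion converges
  unconditionally to \<open>f\<close> on a ball around \<open>z\<close>.\<close>

definition real_analytic_at :: "('a::euclidean_space \<Rightarrow> real) \<Rightarrow> 'a \<Rightarrow> bool" where
  "real_analytic_at f z \<longleftrightarrow>
     (\<exists>c. \<exists>r>0. \<forall>w\<in>ball z r.
        ((\<lambda>\<alpha>. c \<alpha> * (\<Prod>b\<in>Basis. ((w - z) \<bullet> b) ^ \<alpha> b)) has_sum f w)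
          (Basis \<rightarrow>\<^sub>E (UNIV :: nat set)))"

text \<open>\<open>P l x y\<close> stands for \<open>P(x, y; l)\<close>. Functions are total, but nothing is required of
  them away from a neighbourhood of \<open>x = y = 0\<close>, which may depend on the parameter.\<close>

definition analytic_family :: "(real ^ 'd \<Rightarrow> real \<Rightarrow> real \<Rightarrow> real) \<Rightarrow> bool" where
  "analytic_family P \<longleftrightarrow> (\<forall>l. real_analytic_at (\<lambda>(l, x, y). P l x y) (l, 0, 0))"


section \<open>Monodromic singularities\<close>

text \<open>The forward orbit of \<open>(P, Q)\<close> through \<open>z\<close> makes a complete turn around the origin
  (clockwise or counterclockwise) inside the punctured disc of radius \<open>\<epsilon>\<close>; \<open>\<theta>\<close> is a
  continuous choice of the ordinary polar angle along the orbit.\<close>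

definition full_turn ::
  "(real \<Rightarrow> real \<Rightarrow> real) \<Rightarrow> (real \<Rightarrow> real \<Rightarrow> real) \<Rightarrow> real \<Rightarrow> real \<times> real \<Rightarrow> bool" where
  "full_turn P Q \<epsilon> z \<longleftrightarrow>
     (\<exists>T>0. \<exists>x y \<theta> :: real \<Rightarrow> real.
        (x 0, y 0) = z \<and>
        continuous_on {0..T} \<theta> \<and>
        (\<forall>t\<in>{0..T}.
           0 < norm (x t, y t) \<and> norm (x t, y t) < \<epsilon> \<and>
           (x has_real_derivative P (x t) (y t)) (at t within {0..T}) \<and>
           (y has_real_derivative Q (x t) (y t)) (at t within {0..T}) \<and>
           x t = norm (x t, y t) * cos (\<theta> t) \<and>
           y t = norm (x t, y t) * sin (\<theta> t)) \<and>
        \<bar>\<theta> T - \<theta> 0\<bar> = 2 * pi)"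

text \<open>Reversing the sign of the field reverses time, so the last conjunct says that the
  backward orbit turns around the origin as well.\<close>

definition monodromic_origin ::
  "(real \<Rightarrow> real \<Rightarrow> real) \<Rightarrow> (real \<Rightarrow> real \<Rightarrow> real) \<Rightarrow> bool" where
  "monodromic_origin P Q \<longleftrightarrow>
     P 0 0 = 0 \<and> Q 0 0 = 0 \<and>
     (\<forall>\<epsilon>>0. \<exists>\<delta>>0. \<forall>z. 0 < norm z \<and> norm z < \<delta> \<longrightarrow>
        full_turn P Q \<epsilon> z \<and> full_turn (\<lambda>x y. - P x y) (\<lambda>x y. - Q x y) \<epsilon> z)"

definition monodromic_parameters ::
  "(real ^ 'd \<Rightarrow> real \<Rightarrow> real \<Rightarrow> real) \<Rightarrow> (real ^ 'd \<Rightarrow> real \<Rightarrow> real \<Rightarrow> real) \<Rightarrow> (real ^ 'd) set" where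
  "monodromic_parameters P Q = {l. monodromic_origin (P l) (Q l)}"


section \<open>Newton diagram and weights\<close>

definition taylor_coeff :: "(real \<Rightarrow> real \<Rightarrow> real) \<Rightarrow> nat \<Rightarrow> nat \<Rightarrow> real" where
  "taylor_coeff f =
     (THE c. \<exists>r>0. \<forall>x y. \<bar>x\<bar> < r \<and> \<bar>y\<bar> < r \<longrightarrow>
        ((\<lambda>(i, j). c i j * x ^ i * y ^ j) has_sum f x y) UNIV)"

text \<open>The indexing is shifted: \<open>P = \<Sum> a\<^sub>i\<^sub>j x\<^sup>i y\<^sup>j\<^sup>-\<^sup>1\<close> and
  \<open>Q = \<Sum> b\<^sub>i\<^sub>j x\<^sup>i\<^sup>-\<^sup>1 y\<^sup>j\<close>.\<close>

definition field_support ::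
  "(real \<Rightarrow> real \<Rightarrow> real) \<Rightarrow> (real \<Rightarrow> real \<Rightarrow> real) \<Rightarrow> (nat \<times> nat) set" where
  "field_support P Q =
     {(i, j). (j \<ge> 1 \<and> taylor_coeff P i (j - 1) \<noteq> 0) \<or> (i \<ge> 1 \<and> taylor_coeff Q (i - 1) j \<noteq> 0)}"

definition newton_polyhedron ::
  "(real \<Rightarrow> real \<Rightarrow> real) \<Rightarrow> (real \<Rightarrow> real \<Rightarrow> real) \<Rightarrow> (real \<times> real) set" where
  "newton_polyhedron P Q =
     convex hull (\<Union>(i, j)\<in>field_support P Q. {(u, v). real i \<le> u \<and> real j \<le> v})"

text \<open>The boundary of the polyhedron is made of a polygon and two unbounded rays; the edges
  of the polygon are the bounded ones.\<close>

definition newton_diagram ::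
  "(real \<Rightarrow> real \<Rightarrow> real) \<Rightarrow> (real \<Rightarrow> real \<Rightarrow> real) \<Rightarrow> (real \<times> real) set set" where
  "newton_diagram P Q = {e. e edge_of newton_polyhedron P Q \<and> bounded e}"

text \<open>The quotient on the right is the tangent of the angle between the edge and the ordinate
  axis. Bounded edges are strictly decreasing, so \<open>p u + q v\<close> is constant along them.\<close>

definition newton_weights ::
  "(real \<Rightarrow> real \<Rightarrow> real) \<Rightarrow> (real \<Rightarrow> real \<Rightarrow> real) \<Rightarrow> (nat \<times> nat) set" where
  "newton_weights P Q =
     {(p, q). 0 < p \<and> 0 < q \<and> coprime p q \<and>
        (\<exists>e\<in>newton_diagram P Q. \<forall>z\<in>e. \<forall>w\<in>e. z \<noteq> w \<longrightarrow>
           real q / real p = \<bar>fst z - fst w\<bar> / \<bar>snd z - snd w\<bar>)}"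


section \<open>Quasihomogeneous expansion and polar equation\<close>

definition quasihom_part ::
  "nat \<Rightarrow> nat \<Rightarrow> (real \<Rightarrow> real \<Rightarrow> real) \<Rightarrow> int \<Rightarrow> real \<Rightarrow> real \<Rightarrow> real" where
  "quasihom_part p q f k x y =
     (\<Sum>(i, j) | int (p * i + q * j) = k. taylor_coeff f i j * x ^ i * y ^ j)"

definition quasihom_component ::
  "nat \<Rightarrow> nat \<Rightarrow> (real \<Rightarrow> real \<Rightarrow> real) \<Rightarrow> (real \<Rightarrow> real \<Rightarrow> real) \<Rightarrow> int \<Rightarrow> real \<times> real \<Rightarrow> real \<times> real"
  where
  "quasihom_component p q P Q j =
     (\<lambda>(x, y). (quasihom_part p q P (int p + j) x y, quasihom_part p q Q (int q + j) x y))"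

definition leading_degree ::
  "nat \<Rightarrow> nat \<Rightarrow> (real \<Rightarrow> real \<Rightarrow> real) \<Rightarrow> (real \<Rightarrow> real \<Rightarrow> real) \<Rightarrow> int" where
  "leading_degree p q P Q =
     (THE r. quasihom_component p q P Q r \<noteq> (\<lambda>_. (0, 0)) \<and>
             (\<forall>j<r. quasihom_component p q P Q j = (\<lambda>_. (0, 0))))"

text \<open>Solving \<open>P = p \<rho>\<^sup>p\<^sup>-\<^sup>1 cos \<phi> \<rho>' - \<rho>\<^sup>p sin \<phi> \<phi>'\<close> and
  \<open>Q = q \<rho>\<^sup>q\<^sup>-\<^sup>1 sin \<phi> \<rho>' + \<rho>\<^sup>q cos \<phi> \<phi>'\<close> for \<open>\<rho>'\<close> and \<open>\<phi>'\<close> and dividing by \<open>\<rho>\<^sup>r\<close>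
  gives the formulas for \<open>\<rho> > 0\<close>; the values at \<open>\<rho> = 0\<close> are the analytic extensions.\<close>

definition polar_R ::
  "(real \<Rightarrow> real \<Rightarrow> real) \<Rightarrow> (real \<Rightarrow> real \<Rightarrow> real) \<Rightarrow> nat \<Rightarrow> nat \<Rightarrow> real \<Rightarrow> real \<Rightarrow> real" where
  "polar_R P Q p q \<phi> \<rho> =
     (if \<rho> = 0 then 0
      else let x = \<rho> ^ p * cos \<phi>; y = \<rho> ^ q * sin \<phi> in
        (\<rho> powi (1 - int p) * cos \<phi> * P x y + \<rho> powi (1 - int q) * sin \<phi> * Q x y)
          / (real p * (cos \<phi>)\<^sup>2 + real q * (sin \<phi>)\<^sup>2)
          / \<rho> powi leading_degree p q P Q)"

definition polar_Theta ::
  "(real \<Rightarrow> real \<Rightarrow> real) \<Rightarrow> (real \<Rightarrow> real \<Rightarrow> real) \<Rightarrow> nat \<Rightarrow> nat \<Rightarrow> real \<Rightarrow> real \<Rightarrow> real" where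
  "polar_Theta P Q p q \<phi> \<rho> =
     (if \<rho> = 0 then
        let (A, B) = quasihom_component p q P Q (leading_degree p q P Q) (cos \<phi>, sin \<phi>) in
          (real p * cos \<phi> * B - real q * sin \<phi> * A)
            / (real p * (cos \<phi>)\<^sup>2 + real q * (sin \<phi>)\<^sup>2)
      else let x = \<rho> ^ p * cos \<phi>; y = \<rho> ^ q * sin \<phi> in
        (real p * \<rho> powi (- int q) * cos \<phi> * Q x y - real q * \<rho> powi (- int p) * sin \<phi> * P x y)
          / (real p * (cos \<phi>)\<^sup>2 + real q * (sin \<phi>)\<^sup>2)
          / \<rho> powi leading_degree p q P Q)"

definition polar_F ::
  "(real \<Rightarrow> real \<Rightarrow> real) \<Rightarrow> (real \<Rightarrow> real \<Rightarrow> real) \<Rightarrow> nat \<Rightarrow> nat \<Rightarrow> real \<Rightarrow> real \<Rightarrow> real" where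
  "polar_F P Q p q \<phi> \<rho> = polar_R P Q p q \<phi> \<rho> / polar_Theta P Q p q \<phi> \<rho>"

text \<open>The cylinder is represented by its universal cover: the angle is a real number and
  functions on the cylinder are \<open>2\<pi>\<close>-periodic in it. The condition \<open>\<rho> \<ll> 1\<close> is read
  through a radius \<open>\<delta>\<close> that may be taken as small as needed.\<close>

definition cylinder :: "real \<Rightarrow> (real \<times> real) set" where
  "cylinder \<delta> = {(\<phi>, \<rho>). 0 \<le> \<rho> \<and> \<rho> < \<delta>}"

definition base_circle :: "(real \<times> real) set" where
  "base_circle = {(\<phi>, \<rho>). \<rho> = 0}"

definition Theta_zeros ::
  "(real \<Rightarrow> real \<Rightarrow> real) \<Rightarrow> (real \<Rightarrow> real \<Rightarrow> real) \<Rightarrow> nat \<Rightarrow> nat \<Rightarrow> real \<Rightarrow> (real \<times> real) set" where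
  "Theta_zeros P Q p q \<delta> = {(\<phi>, \<rho>) \<in> cylinder \<delta>. polar_Theta P Q p q \<phi> \<rho> = 0}"

definition critical_parameters ::
  "(real ^ 'd \<Rightarrow> real \<Rightarrow> real \<Rightarrow> real) \<Rightarrow> (real ^ 'd \<Rightarrow> real \<Rightarrow> real \<Rightarrow> real) \<Rightarrow> nat \<Rightarrow> nat \<Rightarrow>
     (real ^ 'd) set" where
  "critical_parameters P Q p q =
     {l \<in> monodromic_parameters P Q. \<forall>\<delta>>0. Theta_zeros (P l) (Q l) p q \<delta> - base_circle \<noteq> {}}"


section \<open>Inverse integrating factors and the Poincare map\<close>

definition C1_on :: "('a::real_normed_vector \<Rightarrow> 'b::real_normed_vector) \<Rightarrow> 'a set \<Rightarrow> bool" where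
  "C1_on f S \<longleftrightarrow>
     (\<exists>f' :: 'a \<Rightarrow> 'a \<Rightarrow>\<^sub>L 'b.
        (\<forall>x\<in>S. (f has_derivative blinfun_apply (f' x)) (at x)) \<and> continuous_on S f')"

definition inverse_integrating_factor ::
  "(real \<Rightarrow> real \<Rightarrow> real) \<Rightarrow> (real \<Rightarrow> real \<Rightarrow> real) \<Rightarrow> nat \<Rightarrow> nat \<Rightarrow> (real \<Rightarrow> real \<Rightarrow> real) \<Rightarrow> bool"
  where
  "inverse_integrating_factor P Q p q V \<longleftrightarrow>
     (\<exists>\<delta>>0. let D = cylinder \<delta> - (Theta_zeros P Q p q \<delta> \<union> base_circle) in
        (\<forall>(\<phi>, \<rho>)\<in>D. V (\<phi> + 2 * pi) \<rho> = V \<phi> \<rho>) \<and>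
        C1_on (\<lambda>(\<phi>, \<rho>). V \<phi> \<rho>) D \<and>
        (\<forall>U. open U \<and> U \<noteq> {} \<and> U \<subseteq> D \<longrightarrow> (\<exists>(\<phi>, \<rho>)\<in>U. V \<phi> \<rho> \<noteq> 0)) \<and>
        (\<forall>(\<phi>, \<rho>)\<in>D.
           deriv (\<lambda>s. V s \<rho>) \<phi> + deriv (\<lambda>s. V \<phi> s) \<rho> * polar_F P Q p q \<phi> \<rho>
             = deriv (\<lambda>s. polar_F P Q p q \<phi> s) \<rho> * V \<phi> \<rho>))"

text \<open>\<open>u\<close> solves \<open>d\<rho>/d\<phi> = F(\<phi>, \<rho>)\<close> on \<open>[0, 2\<pi>]\<close> with \<open>u 0 = \<rho>0\<close>, inside the part of the
  cylinder of radius \<open>\<delta>\<close> where the equation makes sense.\<close>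

definition polar_solution ::
  "(real \<Rightarrow> real \<Rightarrow> real) \<Rightarrow> (real \<Rightarrow> real \<Rightarrow> real) \<Rightarrow> nat \<Rightarrow> nat \<Rightarrow> real \<Rightarrow> real \<Rightarrow>
     (real \<Rightarrow> real) \<Rightarrow> bool" where
  "polar_solution P Q p q \<delta> \<rho>0 u \<longleftrightarrow>
     u 0 = \<rho>0 \<and>
     (\<forall>\<phi>\<in>{0..2 * pi}.
        (\<phi>, u \<phi>) \<in> cylinder \<delta> - (Theta_zeros P Q p q \<delta> \<union> base_circle) \<and>
        (u has_real_derivative polar_F P Q p q \<phi> (u \<phi>)) (at \<phi> within {0..2 * pi}))"

text \<open>The Poincare map is a germ at \<open>\<rho>0 = 0\<close> from the right: values at large \<open>\<rho>0\<close> are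
  irrelevant, and solutions starting close to \<open>\<rho> = 0\<close> are those that remain in a thin
  cylinder for a whole turn.\<close>

definition poincare_map ::
  "(real \<Rightarrow> real \<Rightarrow> real) \<Rightarrow> (real \<Rightarrow> real \<Rightarrow> real) \<Rightarrow> nat \<Rightarrow> nat \<Rightarrow> (real \<Rightarrow> real) \<Rightarrow> bool" where
  "poincare_map P Q p q \<Psi> \<longleftrightarrow>
     (\<exists>\<Phi> :: real \<Rightarrow> real \<Rightarrow> real.
        (\<forall>\<delta>>0. \<forall>\<^sub>F \<rho>0 in at_right 0. polar_solution P Q p q \<delta> \<rho>0 (\<lambda>\<phi>. \<Phi> \<phi> \<rho>0)) \<and>
        (\<forall>\<^sub>F \<rho>0 in at_right 0. \<Psi> \<rho>0 = \<Phi> (2 * pi) \<rho>0))"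

end

theory Submission
  imports Defs
begin

text \<open>
  Write \<open>F\<close> for the right-hand side of the polar equation and \<open>F1\<close> for its partial derivative in
  \<open>\<rho>\<close>. Two scalar functions of the angle solve the same linear equation
  \<open>w' = F1 \<phi> (u \<phi>) * w\<close> along a solution \<open>u\<close> with \<open>u 0 = \<rho>0\<close>: the derivative of the solution with
  respect to the initial value (the first variation), and, by the partial differential equation
  defining an inverse integrating factor, the function \<open>\<phi> \<mapsto> V \<phi> (u \<phi>)\<close>. Over one turn both are
  therefore multiplied by the same number, the exponential of the integral of \<open>F1 \<phi> (u \<phi>)\<close>. For the
  variation this number is \<open>\<Psi>' \<rho>0\<close>; for \<open>V\<close> it is the factor that carries
  \<open>V 0 \<rho>0\<close> to \<open>V (2 * pi) (\<Psi> \<rho>0)\<close>, and \<open>V\<close> is periodic in the angle. The two halves are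
  \<open>flow_has_derivative\<close> and \<open>inverse_integrating_factor_along_solution\<close>.

  Because the equation is scalar, the variation is accessible without a general theory of
  differential equations: the difference of two solutions solves a linear equation whose coefficient
  is the mean of \<open>F1\<close> over the segment between them, so it has a closed form
  (\<open>solution_difference\<close>), from which uniqueness, monotonicity and differentiability in the
  initial value are all read off. It suffices that \<open>F\<close> is \<open>C\<^sup>1\<close> in \<open>\<rho>\<close> off the circle \<open>\<rho> = 0\<close>,
  which follows from termwise differentiation of the power series of the field.

  What requires monodromy is the existence of solutions over a whole turn. The function \<open>\<Theta>\<close> may
  vanish on the circle \<open>\<rho> = 0\<close>, so \<open>F\<close> can be unbounded near it, and solutions cannot be continued
  by estimating \<open>F\<close>. Instead an actual orbit that turns around the origin is lifted to the
  weighted polar coordinates (\<open>weighted_polar_lift\<close>). Off the critical parameters \<open>\<Theta>\<close> has a constant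
  sign for small \<open>\<rho> > 0\<close>, so the weighted angle is strictly monotone along the orbit and can serve
  as the independent variable (\<open>full_turn_imp_polar_solution\<close>). If that sign is negative the angle
  decreases in time, and the backward orbit is used.
\<close>

section \<open>Analytic fields are continuously differentiable\<close>

text \<open>On the polydisc of half the radius a differentiated monomial is at most a constant times the
  undifferentiated one at the full radius, because \<open>i \<le> 2 ^ i\<close>. This turns absolute summability at one
  point into a majorant of the differentiated series.\<close>

lemma monomial_derivative_bound:
  fixes x t :: real
  assumes "0 < t" "\<bar>x\<bar> \<le> t / 2"
  shows "\<bar>real i * x ^ (i - 1)\<bar> \<le> 2 / t * t ^ i"
proof (cases i)
  case (Suc k)
  have "real (Suc k) \<le> 2 * 2 ^ k"
    using of_nat_mono[OF less_imp_le[OF less_exp[of "Suc k"]], where ?'a = real] by simp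
  then have k: "real (Suc k) * (1 / 2) ^ k \<le> 2" by (simp add: field_simps)
  have "\<bar>real i * x ^ (i - 1)\<bar> = real (Suc k) * \<bar>x\<bar> ^ k"
    using Suc by (simp add: abs_mult power_abs)
  also have "\<dots> \<le> real (Suc k) * (t / 2) ^ k"
    using assms by (intro mult_left_mono power_mono) auto
  also have "\<dots> = (real (Suc k) * (1 / 2) ^ k) * t ^ k" by (simp add: power_divide)
  also have "\<dots> \<le> 2 * t ^ k" using k assms by (intro mult_right_mono) auto
  also have "\<dots> = 2 / t * t ^ i" using Suc assms by simp
  finally show ?thesis .
qed (use assms in simp)

text \<open>Both partial derivatives are uniform limits of the differentiated partial sums, by the M-test with
  the majorant above; the double index is enumerated by \<open>prod_decode\<close> so that the theorem on termwise
  differentiation of sequences of functions applies.\<close>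

lemma double_power_series_C1:
  fixes c :: "nat \<Rightarrow> nat \<Rightarrow> real" and f :: "real \<times> real \<Rightarrow> real"
  assumes r: "0 < r"
    and f: "\<And>x y. \<bar>x\<bar> \<le> r \<Longrightarrow> \<bar>y\<bar> \<le> r \<Longrightarrow> ((\<lambda>(i, j). c i j * x ^ i * y ^ j) has_sum f (x, y)) UNIV"
  obtains fx fy where
    "\<And>z. z \<in> ball 0 (r / 2) \<Longrightarrow> (f has_derivative (\<lambda>(h, k). fx z * h + fy z * k)) (at z)"
    "continuous_on (ball 0 (r / 2)) fx" "continuous_on (ball 0 (r / 2)) fy"
proof -
  define I J C where "I n = fst (prod_decode n)" and "J n = snd (prod_decode n)"
    and "C n = c (I n) (J n)" for n
  have decoded: "((\<lambda>n. C n * x ^ I n * y ^ J n) has_sum f (x, y)) UNIV" if "\<bar>x\<bar> \<le> r" "\<bar>y\<bar> \<le> r" for x y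
    using has_sum_reindex_bij_betw[OF bij_prod_decode, THEN iffD2, OF f[OF that]]
    by (simp add: split_def I_def J_def C_def)
  note series = has_sum_imp_sums[OF decoded]
  have "(\<lambda>n. C n * r ^ I n * r ^ J n) summable_on UNIV"
    using decoded[of r r] r by (auto simp: summable_on_def)
  then have "(\<lambda>n. \<bar>C n * r ^ I n * r ^ J n\<bar>) summable_on UNIV"
    by (subst (asm) summable_on_iff_abs_summable_on_real) simp
  then have "summable (\<lambda>n. \<bar>C n * r ^ I n * r ^ J n\<bar>)"
    by (rule summable_on_imp_summable)
  then have M: "summable (\<lambda>n. 2 / r * \<bar>C n * r ^ I n * r ^ J n\<bar>)" (is "summable ?M")
    by (rule summable_mult)
  let ?S = "ball (0 :: real \<times> real) (r / 2)"
  have S: "\<bar>fst z\<bar> \<le> r / 2" "\<bar>snd z\<bar> \<le> r / 2" if "z \<in> ?S" for z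
    using that norm_fst_le[of "fst z" "snd z"] norm_snd_le[of "snd z" "fst z"] by auto
  define gx gy :: "nat \<Rightarrow> real \<times> real \<Rightarrow> real" where
    "gx n z = C n * (real (I n) * fst z ^ (I n - 1)) * snd z ^ J n" and
    "gy n z = C n * fst z ^ I n * (real (J n) * snd z ^ (J n - 1))" for n z
  have pow: "\<bar>x ^ i\<bar> \<le> r ^ i" if "\<bar>x\<bar> \<le> r / 2" for x i
    using that r power_mono[of "\<bar>x\<bar>" r i] by (simp add: power_abs)
  have bdx: "norm (gx n z) \<le> ?M n" if "z \<in> ?S" for n z
  proof -
    have "norm (gx n z) \<le> \<bar>C n\<bar> * (2 / r * r ^ I n) * r ^ J n"
      unfolding gx_def real_norm_def abs_mult[of _ "_ ^ J n"] abs_mult[of "C n"]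
      using r S[OF that] by (intro mult_mono monomial_derivative_bound pow) auto
    then show ?thesis using r by (simp add: abs_mult mult_ac)
  qed
  have bdy: "norm (gy n z) \<le> ?M n" if "z \<in> ?S" for n z
  proof -
    have "norm (gy n z) \<le> \<bar>C n\<bar> * r ^ I n * (2 / r * r ^ J n)"
      unfolding gy_def real_norm_def abs_mult[of _ "real _ * _"] abs_mult[of "C n"]
      using r S[OF that] by (intro mult_mono monomial_derivative_bound pow) auto
    then show ?thesis using r by (simp add: abs_mult mult_ac)
  qed
  define fx fy where "fx z = (\<Sum>n. gx n z)" and "fy z = (\<Sum>n. gy n z)" for z
  have ux: "uniform_limit ?S (\<lambda>n z. \<Sum>i<n. gx i z) fx sequentially"
    unfolding fx_def by (rule Weierstrass_m_test[OF bdx M])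
  have uy: "uniform_limit ?S (\<lambda>n z. \<Sum>i<n. gy i z) fy sequentially"
    unfolding fy_def by (rule Weierstrass_m_test[OF bdy M])
  have "continuous_on ?S fx"
    by (rule uniform_limit_theorem[OF _ ux]) (auto simp: gx_def intro!: always_eventually continuous_intros)
  moreover have "continuous_on ?S fy"
    by (rule uniform_limit_theorem[OF _ uy]) (auto simp: gy_def intro!: always_eventually continuous_intros)
  moreover have "(f has_derivative (\<lambda>(h, k). fx z * h + fy z * k)) (at z)" if z: "z \<in> ?S" for z
  proof -
    have "\<exists>g. \<forall>w\<in>?S. (\<lambda>n. C n * fst w ^ I n * snd w ^ J n) sums g w \<and>
        (g has_derivative (\<lambda>(h, k). fx w * h + fy w * k)) (at w within ?S)"
    proof (rule has_derivative_series)
      show "((\<lambda>w. C n * fst w ^ I n * snd w ^ J n) has_derivative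
          (\<lambda>(h, k). gx n w * h + gy n w * k)) (at w within ?S)" for n w
        unfolding split_def gx_def gy_def
        by (rule derivative_eq_intros refl | (simp add: algebra_simps; fail))+
      show "\<forall>\<^sub>F n in sequentially. \<forall>w\<in>?S. \<forall>h.
          norm ((\<Sum>i<n. (\<lambda>(h, k). gx i w * h + gy i w * k) h) - (\<lambda>(h, k). fx w * h + fy w * k) h)
            \<le> e * norm h" if e: "0 < e" for e
      proof -
        have "\<forall>\<^sub>F n in sequentially. (\<forall>w\<in>?S. dist (\<Sum>i<n. gx i w) (fx w) < e / 2)
            \<and> (\<forall>w\<in>?S. dist (\<Sum>i<n. gy i w) (fy w) < e / 2)"
          using e by (intro eventually_conj uniform_limitD[OF ux] uniform_limitD[OF uy]) auto
        then show ?thesis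
        proof (rule eventually_mono, intro ballI allI)
          fix n w and h :: "real \<times> real"
          assume *: "(\<forall>w\<in>?S. dist (\<Sum>i<n. gx i w) (fx w) < e / 2)
            \<and> (\<forall>w\<in>?S. dist (\<Sum>i<n. gy i w) (fy w) < e / 2)" and w: "w \<in> ?S"
          have "(\<Sum>i<n. (\<lambda>(h, k). gx i w * h + gy i w * k) h) - (\<lambda>(h, k). fx w * h + fy w * k) h
              = ((\<Sum>i<n. gx i w) - fx w) * fst h + ((\<Sum>i<n. gy i w) - fy w) * snd h"
            by (simp add: split_def sum.distrib left_diff_distrib sum_distrib_right)
          also have "norm \<dots> \<le> e / 2 * norm h + e / 2 * norm h"
            unfolding real_norm_def
          proof (intro order_trans[OF abs_triangle_ineq] add_mono)
            show "\<bar>((\<Sum>i<n. gx i w) - fx w) * fst h\<bar> \<le> e / 2 * norm h"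
              unfolding abs_mult using * w e norm_fst_le[of "fst h" "snd h"]
              by (intro mult_mono) (auto simp: dist_real_def less_imp_le)
            show "\<bar>((\<Sum>i<n. gy i w) - fy w) * snd h\<bar> \<le> e / 2 * norm h"
              unfolding abs_mult using * w e norm_snd_le[of "snd h" "fst h"]
              by (intro mult_mono) (auto simp: dist_real_def less_imp_le)
          qed
          finally show "norm ((\<Sum>i<n. (\<lambda>(h, k). gx i w * h + gy i w * k) h)
              - (\<lambda>(h, k). fx w * h + fy w * k) h) \<le> e * norm h" by simp
        qed
      qed
      show "(\<lambda>n. C n * fst z ^ I n * snd z ^ J n) sums f z"
        using series[of "fst z" "snd z"] S[OF z] r by simp
    qed (use z in auto)
    then obtain g where g: "\<And>w. w \<in> ?S \<Longrightarrow> (\<lambda>n. C n * fst w ^ I n * snd w ^ J n) sums g w"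
      "(g has_derivative (\<lambda>(h, k). fx z * h + fy z * k)) (at z within ?S)"
      using z by blast
    have "f w = g w" if "w \<in> ?S" for w
      using series[of "fst w" "snd w"] S[OF that] r sums_unique2[OF _ g(1)[OF that]] by simp
    then have "(f has_derivative (\<lambda>(h, k). fx z * h + fy z * k)) (at z within ?S)"
      using has_derivative_transform[OF z _ g(2)] by auto
    then show ?thesis using at_within_open[OF z] by simp
  qed
  ultimately show ?thesis using that by blast
qed

text \<open>Fixing the parameter at the centre of the expansion makes every coordinate of the parameter
  displacement zero, so only the multi-indices that vanish on those coordinates contribute. They
  correspond to pairs of exponents of \<open>x\<close> and \<open>y\<close>.\<close>

lemma analytic_family_double_power_series:
  fixes P :: "real ^ 'd \<Rightarrow> real \<Rightarrow> real \<Rightarrow> real"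
  assumes "analytic_family P"
  obtains c r where "0 < r"
    "\<And>x y. \<bar>x\<bar> \<le> r \<Longrightarrow> \<bar>y\<bar> \<le> r \<Longrightarrow> ((\<lambda>(i, j). c i j * x ^ i * y ^ j) has_sum P l x y) UNIV"
proof -
  let ?A = "Basis \<rightarrow>\<^sub>E (UNIV :: nat set) :: (((real ^ 'd) \<times> real \<times> real) \<Rightarrow> nat) set"
  let ?ex = "(0, 1, 0) :: (real ^ 'd) \<times> real \<times> real" and ?ey = "(0, 0, 1) :: (real ^ 'd) \<times> real \<times> real"
  obtain c r where r: "0 < r" and c: "\<And>w. w \<in> ball (l, 0, 0) r \<Longrightarrow>
      ((\<lambda>\<alpha>. c \<alpha> * (\<Prod>b\<in>Basis. ((w - (l, 0, 0)) \<bullet> b) ^ \<alpha> b)) has_sum (\<lambda>(l, x, y). P l x y) w) ?A"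
    using assms unfolding analytic_family_def real_analytic_at_def by blast
  \<comment> \<open>the multi-index with the given exponents in the two plane directions and zero elsewhere\<close>
  define E where "E = (\<lambda>(i, j). (\<lambda>b\<in>Basis. if b = ?ex then i else if b = ?ey then j else 0 :: nat))"
  have basis: "?ex \<in> Basis" "?ey \<in> Basis" by (auto simp: Basis_prod_def)
  have Ex: "E (i, j) ?ex = i" and Ey: "E (i, j) ?ey = j" for i j
    using basis by (auto simp: E_def)
  have inj: "inj E" by (rule injI) (metis Ex Ey surj_pair)
  have range: "range E \<subseteq> ?A" by (auto simp: E_def)
  have "((\<lambda>(i, j). c (E (i, j)) * x ^ i * y ^ j) has_sum P l x y) UNIV"
    if xy: "\<bar>x\<bar> \<le> r / 3" "\<bar>y\<bar> \<le> r / 3" for x y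
  proof -
    let ?w = "(l, x, y)"
    have "norm (x, y) \<le> \<bar>x\<bar> + \<bar>y\<bar>" using norm_Pair_le[of x y] by simp
    then have "dist (l, 0, 0) ?w < r"
      using xy r by (simp add: dist_norm norm_Pair)
    then have "((\<lambda>\<alpha>. c \<alpha> * (\<Prod>b\<in>Basis. ((?w - (l, 0, 0)) \<bullet> b) ^ \<alpha> b)) has_sum P l x y) ?A"
      (is "(?g has_sum _) _") using c[of ?w] by simp
    also have "?this \<longleftrightarrow> (?g has_sum P l x y) (range E)"
    proof (rule has_sum_cong_neutral)
      fix \<alpha> assume \<alpha>: "\<alpha> \<in> ?A - range E"
      have "\<exists>b\<in>Basis. b \<noteq> ?ex \<and> b \<noteq> ?ey \<and> \<alpha> b \<noteq> 0"
      proof (rule ccontr)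
        assume *: "\<not> ?thesis"
        have "\<alpha> = E (\<alpha> ?ex, \<alpha> ?ey)"
          using \<alpha> * by (auto simp: E_def restrict_def PiE_def extensional_def fun_eq_iff)
        then show False using \<alpha> by blast
      qed
      then obtain b where b: "b \<in> Basis" "b \<noteq> ?ex" "b \<noteq> ?ey" "\<alpha> b \<noteq> 0" by blast
      then have "(?w - (l, 0, 0)) \<bullet> b = 0" by (auto simp: Basis_prod_def)
      then have "((?w - (l, 0, 0)) \<bullet> b) ^ \<alpha> b = 0" using b by simp
      then show "?g \<alpha> = 0" using b(1) by (auto simp: prod_zero_iff)
    qed (use range in auto)
    also have "\<dots> \<longleftrightarrow> ((?g \<circ> E) has_sum P l x y) UNIV"
      by (rule has_sum_reindex[OF inj])
    also have "?g \<circ> E = (\<lambda>(i, j). c (E (i, j)) * x ^ i * y ^ j)"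
    proof -
      have "(\<Prod>b\<in>Basis. ((0, x, y) \<bullet> b) ^ E (i, j) b) = x ^ i * y ^ j" for i j
      proof -
        have "(\<Prod>b\<in>Basis. ((0, x, y) \<bullet> b) ^ E (i, j) b) = (\<Prod>b\<in>{?ex, ?ey}. ((0, x, y) \<bullet> b) ^ E (i, j) b)"
          using basis by (intro prod.mono_neutral_right) (auto simp: E_def)
        also have "\<dots> = x ^ i * y ^ j" using basis by (simp add: E_def)
        finally show ?thesis .
      qed
      then show ?thesis by (auto simp: fun_eq_iff mult.assoc)
    qed
    finally show ?thesis .
  qed
  then show ?thesis using that[of "r / 3" "\<lambda>i j. c (E (i, j))"] r by auto
qed

lemma analytic_family_C1:
  fixes P :: "real ^ 'd \<Rightarrow> real \<Rightarrow> real \<Rightarrow> real"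
  assumes "analytic_family P"
  obtains R Px Py where "0 < R"
    "\<And>z. z \<in> ball 0 R \<Longrightarrow> ((\<lambda>(x, y). P l x y) has_derivative (\<lambda>(h, k). Px z * h + Py z * k)) (at z)"
    "continuous_on (ball 0 R) Px" "continuous_on (ball 0 R) Py"
proof -
  obtain c r where r: "0 < r" and
    c: "\<And>x y. \<bar>x\<bar> \<le> r \<Longrightarrow> \<bar>y\<bar> \<le> r \<Longrightarrow> ((\<lambda>(i, j). c i j * x ^ i * y ^ j) has_sum P l x y) UNIV"
  proof -
    show ?thesis by (rule analytic_family_double_power_series[where l = l, OF assms]) (fact that)
  qed
  obtain fx fy where
    "\<And>z. z \<in> ball 0 (r / 2) \<Longrightarrow> ((\<lambda>(x, y). P l x y) has_derivative (\<lambda>(h, k). fx z * h + fy z * k)) (at z)"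
    "continuous_on (ball 0 (r / 2)) fx" "continuous_on (ball 0 (r / 2)) fy"
    by (rule double_power_series_C1[OF r, of c "\<lambda>(x, y). P l x y"]) (use c in auto)
  then show ?thesis using that[of "r / 2" fx fy] r by auto
qed

section \<open>Scalar equations and their first variation\<close>

text \<open>The product of \<open>d\<close> with the inverse of the exponential has zero derivative.\<close>

lemma linear_ode_solution:
  fixes a d :: "real \<Rightarrow> real"
  assumes a: "continuous_on {0..T} a"
    and d: "\<And>\<phi>. \<phi> \<in> {0..T} \<Longrightarrow> (d has_real_derivative a \<phi> * d \<phi>) (at \<phi> within {0..T})"
    and \<phi>: "\<phi> \<in> {0..T}"
  shows "d \<phi> = d 0 * exp (integral {0..\<phi>} a)"
proof -
  let ?A = "\<lambda>\<phi>. integral {0..\<phi>} a"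
  have "((\<lambda>\<phi>. d \<phi> * exp (- ?A \<phi>)) has_real_derivative 0) (at s within {0..T})"
    if s: "s \<in> {0..T}" for s
    using d[OF s] integral_has_real_derivative[OF a s] by (auto intro!: derivative_eq_intros)
  then have "\<exists>c. \<forall>s\<in>{0..T}. d s * exp (- ?A s) = c"
    by (intro has_field_derivative_zero_constant convex_real_interval)
  then obtain c where c: "\<And>s. s \<in> {0..T} \<Longrightarrow> d s * exp (- ?A s) = c" by blast
  have "d \<phi> * exp (- ?A \<phi>) = d 0" using c[OF \<phi>] c[of 0] \<phi> by auto
  then show ?thesis by (simp add: exp_minus field_simps)
qed

text \<open>A scalar equation \<open>d\<rho>/d\<phi> = F(\<phi>, \<rho>)\<close> on the angular interval \<open>[0, T]\<close>, for \<open>\<rho>\<close> in a convex set on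
  which \<open>F\<close> is \<open>C\<^sup>1\<close> in \<open>\<rho>\<close>.\<close>

locale scalar_ode =
  fixes F F1 :: "real \<Rightarrow> real \<Rightarrow> real" and T :: real and J :: "real set"
  assumes convex_J: "convex J"
    and F1: "\<And>\<phi> \<rho>. \<rho> \<in> J \<Longrightarrow> (F \<phi> has_real_derivative F1 \<phi> \<rho>) (at \<rho>)"
    and cont_F1: "continuous_on (UNIV \<times> J) (\<lambda>(\<phi>, \<rho>). F1 \<phi> \<rho>)"
begin

definition solution :: "(real \<Rightarrow> real) \<Rightarrow> bool" where
  "solution u \<longleftrightarrow>
     (\<forall>\<phi>\<in>{0..T}. u \<phi> \<in> J \<and> (u has_real_derivative F \<phi> (u \<phi>)) (at \<phi> within {0..T}))"

lemma solution_continuous: "solution u \<Longrightarrow> continuous_on {0..T} u"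
  unfolding solution_def by (auto simp: continuous_on_eq_continuous_within intro!: DERIV_continuous)

text \<open>The difference quotient of \<open>F \<phi>\<close>, written as an integral: in this form it is visibly continuous in all
  three arguments, including where \<open>\<rho> = \<sigma>\<close>.\<close>

definition mean_slope :: "real \<Rightarrow> real \<Rightarrow> real \<Rightarrow> real" where
  "mean_slope \<phi> \<rho> \<sigma> = integral {0..1} (\<lambda>s. F1 \<phi> (\<sigma> + s * (\<rho> - \<sigma>)))"

lemma segment_in_J: "\<rho> \<in> J \<Longrightarrow> \<sigma> \<in> J \<Longrightarrow> s \<in> {0..1} \<Longrightarrow> \<sigma> + s * (\<rho> - \<sigma>) \<in> J"
  using convexD_alt[OF convex_J, of \<sigma> \<rho> s] by (auto simp: algebra_simps)

lemma mean_slope: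
  assumes "\<rho> \<in> J" "\<sigma> \<in> J"
  shows "F \<phi> \<rho> - F \<phi> \<sigma> = mean_slope \<phi> \<rho> \<sigma> * (\<rho> - \<sigma>)"
proof -
  let ?g = "\<lambda>s. \<sigma> + s * (\<rho> - \<sigma>)"
  have "((\<lambda>s. F \<phi> (?g s)) has_real_derivative F1 \<phi> (?g s) * (\<rho> - \<sigma>)) (at s within {0..1})"
    if "s \<in> {0..1}" for s
    by (rule DERIV_chain2[where g = ?g, OF F1[OF segment_in_J[OF assms that]]])
      (auto intro!: derivative_eq_intros)
  then have "((\<lambda>s. F1 \<phi> (?g s) * (\<rho> - \<sigma>)) has_integral F \<phi> (?g 1) - F \<phi> (?g 0)) {0..1}"
    by (intro fundamental_theorem_of_calculus)
      (auto simp: has_real_derivative_iff_has_vector_derivative)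
  then have "integral {0..1} (\<lambda>s. F1 \<phi> (?g s) * (\<rho> - \<sigma>)) = F \<phi> \<rho> - F \<phi> \<sigma>"
    by (auto dest: integral_unique)
  then show ?thesis by (simp add: mean_slope_def)
qed

lemma mean_slope_refl: "mean_slope \<phi> \<rho> \<rho> = F1 \<phi> \<rho>"
  by (simp add: mean_slope_def)

lemma continuous_on_mean_slope:
  fixes U :: "'a::topological_space set"
  assumes f: "continuous_on U f" and u: "continuous_on U u" "u ` U \<subseteq> J"
    and v: "continuous_on U v" "v ` U \<subseteq> J"
  shows "continuous_on U (\<lambda>z. mean_slope (f z) (u z) (v z))"
proof -
  have "continuous_on (U \<times> {0..1})
      ((\<lambda>(\<phi>, \<rho>). F1 \<phi> \<rho>) \<circ> (\<lambda>(z, s). (f z, v z + s * (u z - v z))))"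
  proof (rule continuous_on_compose[OF _ continuous_on_subset[OF cont_F1]])
    show "continuous_on (U \<times> {0..1}) (\<lambda>(z, s). (f z, v z + s * (u z - v z)))"
      unfolding split_def
      by (intro continuous_intros continuous_on_compose2[OF f] continuous_on_compose2[OF u(1)]
          continuous_on_compose2[OF v(1)]) auto
    show "(\<lambda>(z, s). (f z, v z + s * (u z - v z))) ` (U \<times> {0..1}) \<subseteq> UNIV \<times> J"
      using u(2) v(2) by (auto intro!: segment_in_J)
  qed
  then have "continuous_on U
      (\<lambda>z. integral (cbox 0 1) (\<lambda>s::real. F1 (f z) (v z + s * (u z - v z))))"
    by (intro integral_continuous_on_param) (simp add: o_def split_def)
  then show ?thesis by (simp add: mean_slope_def)
qed

text \<open>Subtracting the two equations gives a linear equation for the difference, with the mean slope as its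
  coefficient.\<close>

lemma solution_difference:
  assumes u: "solution u" and v: "solution v" and \<phi>: "\<phi> \<in> {0..T}"
  shows "u \<phi> - v \<phi> = (u 0 - v 0) * exp (integral {0..\<phi>} (\<lambda>s. mean_slope s (u s) (v s)))"
proof (rule linear_ode_solution[OF _ _ \<phi>])
  show "continuous_on {0..T} (\<lambda>s. mean_slope s (u s) (v s))"
    using u v by (intro continuous_on_mean_slope continuous_intros solution_continuous)
      (auto simp: solution_def)
  fix s assume s: "s \<in> {0..T}"
  have "((\<lambda>s. u s - v s) has_real_derivative F s (u s) - F s (v s)) (at s within {0..T})"
    using u v s by (intro derivative_intros) (auto simp: solution_def)
  then show "((\<lambda>s. u s - v s) has_real_derivative mean_slope s (u s) (v s) * (u s - v s))
      (at s within {0..T})"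
    using mean_slope[of "u s" "v s" s] u v s by (simp add: solution_def)
qed

lemma solution_unique:
  "solution u \<Longrightarrow> solution v \<Longrightarrow> u 0 = v 0 \<Longrightarrow> \<phi> \<in> {0..T} \<Longrightarrow> u \<phi> = v \<phi>"
  using solution_difference[of u v \<phi>] by simp

lemma solution_mono:
  "solution u \<Longrightarrow> solution v \<Longrightarrow> u 0 \<le> v 0 \<Longrightarrow> \<phi> \<in> {0..T} \<Longrightarrow> u \<phi> \<le> v \<phi>"
  using solution_difference[of v u \<phi>] by (smt (verit) exp_ge_zero mult_nonneg_nonneg)

text \<open>Solutions starting in \<open>[a, b]\<close> stay between the two extreme ones by monotonicity, so all of them run
  in one compact region, where \<open>F1\<close> is bounded. The closed form of the difference then gives a
  Lipschitz estimate in the initial value that is uniform in \<open>\<phi>\<close>.\<close>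

lemma solutions_jointly_continuous:
  assumes sol: "\<And>\<rho>. \<rho> \<in> {a..b} \<Longrightarrow> solution (\<lambda>\<phi>. \<Phi> \<phi> \<rho>)"
    and init: "\<And>\<rho>. \<rho> \<in> {a..b} \<Longrightarrow> \<Phi> 0 \<rho> = \<rho>"
  shows "continuous_on ({a..b} \<times> {0..T}) (\<lambda>(\<rho>, \<phi>). \<Phi> \<phi> \<rho>)"
proof (cases "a \<le> b \<and> 0 \<le> T")
  case True
  then have ab: "a \<in> {a..b}" "b \<in> {a..b}" by auto
  let ?lo = "\<lambda>\<phi>. \<Phi> \<phi> a" and ?hi = "\<lambda>\<phi>. \<Phi> \<phi> b"
  let ?K = "(\<lambda>(\<phi>, s). (\<phi>, ?lo \<phi> + s * (?hi \<phi> - ?lo \<phi>))) ` ({0..T} \<times> {0..1::real})"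
  have sub: "?K \<subseteq> UNIV \<times> J"
    using sol[OF ab(1)] sol[OF ab(2)] by (auto simp: solution_def intro!: segment_in_J)
  have "compact ?K"
    unfolding split_def
    by (rule compact_continuous_image)
      (use ab in \<open>auto intro!: compact_Times continuous_intros
        continuous_on_compose2[OF solution_continuous[OF sol]]\<close>)
  then have "bounded ((\<lambda>(\<phi>, \<rho>). F1 \<phi> \<rho>) ` ?K)"
    by (rule compact_imp_bounded[OF compact_continuous_image[OF continuous_on_subset[OF cont_F1 sub]]])
  then obtain B where B: "\<And>z. z \<in> ?K \<Longrightarrow> \<bar>(\<lambda>(\<phi>, \<rho>). F1 \<phi> \<rho>) z\<bar> \<le> B"
    unfolding bounded_iff real_norm_def by blast
  have in_K: "(\<phi>, \<rho>) \<in> ?K" if "\<phi> \<in> {0..T}" "?lo \<phi> \<le> \<rho>" "\<rho> \<le> ?hi \<phi>" for \<phi> \<rho>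
  proof (cases "?lo \<phi> = ?hi \<phi>")
    case True
    then show ?thesis using that by (auto simp: image_iff intro!: bexI[of _ "(\<phi>, 0)"])
  next
    case False
    let ?r = "(\<rho> - ?lo \<phi>) / (?hi \<phi> - ?lo \<phi>)"
    have "?r \<in> {0..1}" using that False by (auto simp: divide_simps)
    moreover have "\<rho> = ?lo \<phi> + ?r * (?hi \<phi> - ?lo \<phi>)" using False by simp
    ultimately obtain r where "r \<in> {0..1}" "\<rho> = ?lo \<phi> + r * (?hi \<phi> - ?lo \<phi>)" by blast
    then show ?thesis using that(1) by (intro image_eqI[of _ _ "(\<phi>, r)"]) simp_all
  qed
  have between: "?lo \<phi> \<le> \<Phi> \<phi> \<rho>" "\<Phi> \<phi> \<rho> \<le> ?hi \<phi>" if "\<phi> \<in> {0..T}" "\<rho> \<in> {a..b}" for \<phi> \<rho>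
    using solution_mono[OF sol[OF ab(1)] sol[OF that(2)] _ that(1)]
      solution_mono[OF sol[OF that(2)] sol[OF ab(2)] _ that(1)] init ab that by auto
  have lip: "\<bar>\<Phi> \<phi> \<rho> - \<Phi> \<phi> \<sigma>\<bar> \<le> exp (B * T) * \<bar>\<rho> - \<sigma>\<bar>"
    if \<phi>: "\<phi> \<in> {0..T}" and \<rho>: "\<rho> \<in> {a..b}" and \<sigma>: "\<sigma> \<in> {a..b}" for \<phi> \<rho> \<sigma>
  proof -
    let ?m = "\<lambda>s. mean_slope s (\<Phi> s \<rho>) (\<Phi> s \<sigma>)"
    have B0: "0 \<le> B" using B[OF in_K[of 0 "?lo 0"]] between[of 0 a] True by force
    have "\<bar>?m s\<bar> \<le> B" if s: "s \<in> {0..T}" for s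
    proof -
      have "(s, \<Phi> s \<sigma> + r * (\<Phi> s \<rho> - \<Phi> s \<sigma>)) \<in> ?K" if r: "r \<in> {0..1}" for r
      proof (rule in_K[OF s])
        have "\<Phi> s \<sigma> + r * (\<Phi> s \<rho> - \<Phi> s \<sigma>) \<in> {?lo s..?hi s}"
          using convexD_alt[OF convex_real_interval(5), of "\<Phi> s \<sigma>" "?lo s" "?hi s" "\<Phi> s \<rho>" r]
            between[OF s \<rho>] between[OF s \<sigma>] r by (auto simp: algebra_simps)
        then show "?lo s \<le> \<Phi> s \<sigma> + r * (\<Phi> s \<rho> - \<Phi> s \<sigma>)" "\<Phi> s \<sigma> + r * (\<Phi> s \<rho> - \<Phi> s \<sigma>) \<le> ?hi s"
          by auto
      qed
      then have bd: "\<And>r. r \<in> {0..1} \<Longrightarrow> \<bar>F1 s (\<Phi> s \<sigma> + r * (\<Phi> s \<rho> - \<Phi> s \<sigma>))\<bar> \<le> B"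
        using B by fastforce
      have "norm (?m s) \<le> B * (1 - 0)"
        unfolding mean_slope_def
      proof (rule integral_bound)
        have "continuous_on {0..1} ((\<lambda>(\<phi>, \<rho>). F1 \<phi> \<rho>) \<circ> (\<lambda>r. (s, \<Phi> s \<sigma> + r * (\<Phi> s \<rho> - \<Phi> s \<sigma>))))"
          by (intro continuous_on_compose continuous_intros continuous_on_subset[OF cont_F1])
            (use sol[OF \<rho>] sol[OF \<sigma>] s in \<open>auto simp: solution_def intro!: segment_in_J\<close>)
        then show "continuous_on {0..1} (\<lambda>r. F1 s (\<Phi> s \<sigma> + r * (\<Phi> s \<rho> - \<Phi> s \<sigma>)))"
          by (simp add: o_def)
      qed (use bd in auto)
      then show ?thesis by simp
    qed
    moreover have "continuous_on {0..T} ?m"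
      by (intro continuous_on_mean_slope continuous_on_id solution_continuous sol \<rho> \<sigma>)
        (use sol[OF \<rho>] sol[OF \<sigma>] in \<open>auto simp: solution_def\<close>)
    then have "continuous_on {0..\<phi>} ?m"
      by (rule continuous_on_subset) (use \<phi> in auto)
    ultimately have "norm (integral {0..\<phi>} ?m) \<le> B * (\<phi> - 0)"
      using \<phi> by (intro integral_bound) auto
    also have "\<dots> \<le> B * T" using B0 \<phi> by (intro mult_left_mono) auto
    finally have "exp (integral {0..\<phi>} ?m) \<le> exp (B * T)" by simp
    then show ?thesis
      using solution_difference[OF sol[OF \<rho>] sol[OF \<sigma>] \<phi>] init[OF \<rho>] init[OF \<sigma>]
      by (simp add: abs_mult mult.commute mult_left_mono)
  qed
  show ?thesis
  proof (clarsimp simp: continuous_on_eq_continuous_within)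
    fix \<sigma> \<psi> assume *: "a \<le> \<sigma>" "\<sigma> \<le> b" "0 \<le> \<psi>" "\<psi> \<le> T"
    let ?at = "at (\<sigma>, \<psi>) within {a..b} \<times> {0..T}"
    have "((\<lambda>z. \<Phi> (snd z) \<sigma>) \<longlongrightarrow> \<Phi> \<psi> \<sigma>) ?at"
      using continuous_on_compose2[OF solution_continuous[OF sol] continuous_on_snd[OF continuous_on_id],
          of \<sigma> "{a..b} \<times> {0..T}"] * by (auto simp: continuous_on_def split_def)
    moreover have "((\<lambda>z. \<Phi> (snd z) (fst z) - \<Phi> (snd z) \<sigma>) \<longlongrightarrow> 0) ?at"
    proof (rule Lim_null_comparison)
      show "\<forall>\<^sub>F z in ?at. norm (\<Phi> (snd z) (fst z) - \<Phi> (snd z) \<sigma>) \<le> exp (B * T) * \<bar>fst z - \<sigma>\<bar>"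
        using lip * by (auto simp: eventually_at intro!: exI[of _ 1])
      have "((\<lambda>z. exp (B * T) * \<bar>fst z - \<sigma>\<bar>) \<longlongrightarrow> exp (B * T) * \<bar>fst (\<sigma>, \<psi>) - \<sigma>\<bar>) ?at"
        by (intro tendsto_intros)
      then show "((\<lambda>z. exp (B * T) * \<bar>fst z - \<sigma>\<bar>) \<longlongrightarrow> 0) ?at" by simp
    qed
    ultimately have "((\<lambda>z. \<Phi> (snd z) \<sigma> + (\<Phi> (snd z) (fst z) - \<Phi> (snd z) \<sigma>)) \<longlongrightarrow> \<Phi> \<psi> \<sigma> + 0) ?at"
      by (rule tendsto_add)
    then show "continuous ?at (\<lambda>(\<rho>, \<phi>). \<Phi> \<phi> \<rho>)"
      by (simp add: continuous_within split_def)
  qed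
qed auto

text \<open>The first variation. The difference quotient of \<open>\<Phi> T\<close> at \<open>\<sigma>\<close> equals the exponential of the integrated
  mean slope between \<open>\<Phi> \<phi> \<rho>\<close> and \<open>\<Phi> \<phi> \<sigma>\<close>; this expression also makes sense at \<open>\<rho> = \<sigma>\<close>
  and is continuous there, so its value there is the derivative.\<close>

lemma flow_has_derivative:
  assumes sol: "\<And>\<rho>. \<rho> \<in> {a<..<b} \<Longrightarrow> solution (\<lambda>\<phi>. \<Phi> \<phi> \<rho>)"
    and init: "\<And>\<rho>. \<rho> \<in> {a<..<b} \<Longrightarrow> \<Phi> 0 \<rho> = \<rho>"
    and T: "0 \<le> T" and \<sigma>: "\<sigma> \<in> {a<..<b}"
  shows "(\<Phi> T has_real_derivative exp (integral {0..T} (\<lambda>\<phi>. F1 \<phi> (\<Phi> \<phi> \<sigma>)))) (at \<sigma>)"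
proof -
  obtain c d where cd: "a < c" "c < \<sigma>" "\<sigma> < d" "d < b"
    using \<sigma> dense by (metis greaterThanLessThan_iff)
  let ?g = "\<lambda>\<rho>. exp (integral {0..T} (\<lambda>\<phi>. mean_slope \<phi> (\<Phi> \<phi> \<rho>) (\<Phi> \<phi> \<sigma>)))"
  have J: "\<Phi> \<phi> \<rho> \<in> J" if "\<phi> \<in> {0..T}" "\<rho> \<in> {c..d}" for \<phi> \<rho>
    using sol[of \<rho>] that cd by (auto simp: solution_def)
  have jc: "continuous_on ({c..d} \<times> {0..T}) (\<lambda>(\<rho>, \<phi>). \<Phi> \<phi> \<rho>)"
    by (rule solutions_jointly_continuous[OF sol init]) (use cd in auto)
  have "continuous_on ({c..d} \<times> cbox 0 T) (\<lambda>(\<rho>, \<phi>). mean_slope \<phi> (\<Phi> \<phi> \<rho>) (\<Phi> \<phi> \<sigma>))"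
    unfolding split_def
  proof (rule continuous_on_mean_slope)
    show "continuous_on ({c..d} \<times> cbox 0 T) (\<lambda>z. \<Phi> (snd z) (fst z))"
      using jc by (simp add: split_def)
    show "continuous_on ({c..d} \<times> cbox 0 T) (\<lambda>z. \<Phi> (snd z) \<sigma>)"
      by (rule continuous_on_compose2[OF solution_continuous[OF sol[OF \<sigma>]]])
        (auto intro!: continuous_intros)
  qed (use J cd in \<open>auto intro!: continuous_intros\<close>)
  then have "continuous_on {c..d} (\<lambda>\<rho>. exp (integral (cbox 0 T) (\<lambda>\<phi>. mean_slope \<phi> (\<Phi> \<phi> \<rho>) (\<Phi> \<phi> \<sigma>))))"
    by (intro continuous_intros integral_continuous_on_param)
  then have "isCont ?g \<sigma>"
    using cd by (intro continuous_on_interior[of "{c..d}"]) auto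
  then have lim: "(?g \<longlongrightarrow> ?g \<sigma>) (at \<sigma>)" by (simp add: isCont_def)
  have "\<forall>\<^sub>F \<rho> in at \<sigma>. \<rho> \<in> {a<..<b} \<and> \<rho> \<noteq> \<sigma>"
    using \<sigma> by (intro eventually_conj eventually_at_in_open' eventually_neq_at_within) auto
  then have "\<forall>\<^sub>F \<rho> in at \<sigma>. ?g \<rho> = (\<Phi> T \<rho> - \<Phi> T \<sigma>) / (\<rho> - \<sigma>)"
  proof (rule eventually_mono)
    fix \<rho> assume \<rho>: "\<rho> \<in> {a<..<b} \<and> \<rho> \<noteq> \<sigma>"
    then have "\<Phi> T \<rho> - \<Phi> T \<sigma> = (\<rho> - \<sigma>) * ?g \<rho>"
      using solution_difference[OF sol sol[OF \<sigma>], of \<rho> T] init[of \<rho>] init[OF \<sigma>] T by simp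
    then show "?g \<rho> = (\<Phi> T \<rho> - \<Phi> T \<sigma>) / (\<rho> - \<sigma>)" using \<rho> by simp
  qed
  then have "((\<lambda>\<rho>. (\<Phi> T \<rho> - \<Phi> T \<sigma>) / (\<rho> - \<sigma>)) \<longlongrightarrow> ?g \<sigma>) (at \<sigma>)"
    by (rule Lim_transform_eventually[OF lim])
  then show ?thesis by (simp add: has_field_derivative_iff mean_slope_refl)
qed

text \<open>By the chain rule the derivative of \<open>V \<phi> (u \<phi>)\<close> is the left-hand side of the defining equation of an
  inverse integrating factor, so \<open>V\<close> along \<open>u\<close> solves the equation of the first variation.\<close>

lemma inverse_integrating_factor_along_solution:
  assumes u: "solution u" and T: "0 \<le> T"
    and V: "\<And>\<phi> \<rho>. \<rho> \<in> J \<Longrightarrow> (\<lambda>(\<phi>, \<rho>). V \<phi> \<rho>) differentiable (at (\<phi>, \<rho>))"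
    and pde: "\<And>\<phi> \<rho>. \<rho> \<in> J \<Longrightarrow>
      deriv (\<lambda>s. V s \<rho>) \<phi> + deriv (\<lambda>s. V \<phi> s) \<rho> * F \<phi> \<rho> = F1 \<phi> \<rho> * V \<phi> \<rho>"
  shows "V T (u T) = V 0 (u 0) * exp (integral {0..T} (\<lambda>\<phi>. F1 \<phi> (u \<phi>)))"
proof (rule linear_ode_solution[where d = "\<lambda>\<phi>. V \<phi> (u \<phi>)"])
  have "continuous_on {0..T} ((\<lambda>(\<phi>, \<rho>). F1 \<phi> \<rho>) \<circ> (\<lambda>\<phi>. (\<phi>, u \<phi>)))"
    by (intro continuous_on_compose continuous_intros solution_continuous[OF u]
        continuous_on_subset[OF cont_F1]) (use u in \<open>auto simp: solution_def\<close>)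
  then show "continuous_on {0..T} (\<lambda>\<phi>. F1 \<phi> (u \<phi>))" by (simp add: o_def)
  fix \<phi> assume \<phi>: "\<phi> \<in> {0..T}"
  then have uJ: "u \<phi> \<in> J" and du: "(u has_real_derivative F \<phi> (u \<phi>)) (at \<phi> within {0..T})"
    using u by (auto simp: solution_def)
  obtain D where D: "((\<lambda>(\<phi>, \<rho>). V \<phi> \<rho>) has_derivative D) (at (\<phi>, u \<phi>))"
    using V[OF uJ] unfolding differentiable_def by blast
  then have lin: "linear D" by (simp add: has_derivative_linear)
  have split: "D (h, k) = D (1, 0) * h + D (0, 1) * k" for h k
  proof -
    have "(h, k) = h *\<^sub>R (1, 0) + k *\<^sub>R (0, 1 :: real)" by simp
    then show ?thesis using linear_add[OF lin] linear_scale[OF lin] by (metis mult.commute real_scaleR_def)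
  qed
  have chain: "((\<lambda>s. V (f s) (g s)) has_derivative (\<lambda>h. D (f' h, g' h))) (at x within S)"
    if "(f has_derivative f') (at x within S)" "(g has_derivative g') (at x within S)"
      "f x = \<phi>" "g x = u \<phi>" for f g f' g' :: "real \<Rightarrow> real" and x S
    using has_derivative_compose[OF has_derivative_Pair[OF that(1,2)], of "\<lambda>(\<phi>, \<rho>). V \<phi> \<rho>" D]
      D that(3,4) by simp
  have chain_real: "((\<lambda>s. V (f s) (g s)) has_real_derivative D (1, 0) * f' + D (0, 1) * g') (at x within S)"
    if "(f has_real_derivative f') (at x within S)" "(g has_real_derivative g') (at x within S)"
      "f x = \<phi>" "g x = u \<phi>" for f g f' g' x S
  proof -
    have "(\<lambda>h. D (f' * h, g' * h)) = (*) (D (1, 0) * f' + D (0, 1) * g')"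
      by (rule ext, subst split) (simp add: algebra_simps)
    then show ?thesis
      using chain[of f "(*) f'" x S g "(*) g'"] that
      by (simp add: has_field_derivative_def)
  qed
  have 1: "deriv (\<lambda>s. V s (u \<phi>)) \<phi> = D (1, 0)"
    using chain_real[of "\<lambda>s. s" 1 \<phi> UNIV "\<lambda>_. u \<phi>" 0] by (auto intro: DERIV_imp_deriv)
  have 2: "deriv (\<lambda>s. V \<phi> s) (u \<phi>) = D (0, 1)"
    using chain_real[of "\<lambda>_. \<phi>" 0 "u \<phi>" UNIV "\<lambda>s. s" 1] by (auto intro: DERIV_imp_deriv)
  have "((\<lambda>s. V s (u s)) has_real_derivative D (1, 0) + D (0, 1) * F \<phi> (u \<phi>)) (at \<phi> within {0..T})"
    using chain_real[OF DERIV_ident du] by simp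
  then show "((\<lambda>\<phi>. V \<phi> (u \<phi>)) has_real_derivative F1 \<phi> (u \<phi>) * V \<phi> (u \<phi>)) (at \<phi> within {0..T})"
    using pde[OF uJ, of \<phi>] by (simp add: 1 2)
qed (use T in auto)

end

section \<open>Weighted polar coordinates along a path\<close>

definition scaled_norm_square :: "nat \<Rightarrow> nat \<Rightarrow> real \<Rightarrow> real \<Rightarrow> real \<Rightarrow> real" where
  "scaled_norm_square p q x y \<rho> = (x / \<rho> ^ p)\<^sup>2 + (y / \<rho> ^ q)\<^sup>2"

text \<open>The point \<open>(x, y)\<close> has weighted radius \<open>\<rho>\<close> if \<open>(x / \<rho> ^ p, y / \<rho> ^ q)\<close> lies on the unit circle. Strict
  decrease in \<open>\<rho>\<close> of the distance of that point from the origin makes \<open>\<rho>\<close> unique.\<close>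

definition weighted_radius :: "nat \<Rightarrow> nat \<Rightarrow> real \<Rightarrow> real \<Rightarrow> real" where
  "weighted_radius p q x y = (THE \<rho>. 0 < \<rho> \<and> scaled_norm_square p q x y \<rho> = 1)"

lemma scaled_norm_square_strict_antimono:
  assumes "0 < p" "0 < q" "(x, y) \<noteq> (0, 0)" "0 < \<rho>" "\<rho> < \<sigma>"
  shows "scaled_norm_square p q x y \<sigma> < scaled_norm_square p q x y \<rho>"
proof -
  have less: "(a / \<sigma> ^ n)\<^sup>2 < (a / \<rho> ^ n)\<^sup>2" if "a \<noteq> 0" "0 < n" for a :: real and n
  proof -
    have "\<rho> ^ n < \<sigma> ^ n" "0 < \<rho> ^ n" using assms that by (auto intro: power_strict_mono)
    then have "\<bar>a / \<sigma> ^ n\<bar> < \<bar>a / \<rho> ^ n\<bar>"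
      using that assms by (simp add: abs_divide frac_less2)
    then show ?thesis using power_strict_mono[of "\<bar>a / \<sigma> ^ n\<bar>" "\<bar>a / \<rho> ^ n\<bar>" 2] by (simp only: power2_abs abs_ge_zero zero_less_numeral simp_thms)
  qed
  have le: "(a / \<sigma> ^ n)\<^sup>2 \<le> (a / \<rho> ^ n)\<^sup>2" if "0 < n" for a :: real and n
    using less[of a n] that by (cases "a = 0") auto
  show ?thesis
    unfolding scaled_norm_square_def
    using less[of x p] less[of y q] le[of p x] le[of q y] assms by (cases "x = 0") auto
qed

lemma weighted_radius:
  assumes "0 < p" "0 < q" "(x, y) \<noteq> (0, 0)"
  shows weighted_radius_pos: "0 < weighted_radius p q x y"
    and scaled_norm_square_radius: "scaled_norm_square p q x y (weighted_radius p q x y) = 1"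
proof -
  have big: "1 \<le> (c / a ^ n)\<^sup>2" if "0 < a" "a \<le> 1" "a \<le> \<bar>c\<bar>" "0 < n" for a c :: real and n
  proof -
    have "a ^ n \<le> a" using that power_decreasing[of 1 n a] by simp
    then have "1 \<le> \<bar>c / a ^ n\<bar>" using that by (simp add: abs_divide)
    then show ?thesis using one_le_power[of "\<bar>c / a ^ n\<bar>" 2] by (simp only: power2_abs)
  qed
  obtain a where a: "0 < a" "a \<le> 1" "1 \<le> scaled_norm_square p q x y a"
  proof (cases "x = 0")
    case True
    then have "min 1 \<bar>y\<bar> > 0" using assms by auto
    then show ?thesis using big[of "min 1 \<bar>y\<bar>" y q] assms True that[of "min 1 \<bar>y\<bar>"]
      by (simp add: scaled_norm_square_def)
  next
    case False
    then have "min 1 \<bar>x\<bar> > 0" using assms by auto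
    then show ?thesis using big[of "min 1 \<bar>x\<bar>" x p] assms that[of "min 1 \<bar>x\<bar>"]
      by (simp add: scaled_norm_square_def add_increasing2)
  qed
  \<comment> \<open>a radius so large that both quotients are at most one half\<close>
  define b where "b = 1 + 2 * \<bar>x\<bar> + 2 * \<bar>y\<bar>"
  have small: "(c / b ^ n)\<^sup>2 \<le> (1 / 2)\<^sup>2" if "2 * \<bar>c\<bar> \<le> b" "0 < n" for c :: real and n
  proof -
    have "1 \<le> b" by (simp add: b_def)
    then have "b \<le> b ^ n" using power_increasing[of 1 n b] that by simp
    then have "\<bar>c / b ^ n\<bar> \<le> 1 / 2" using that \<open>1 \<le> b\<close> by (simp add: abs_divide field_simps)
    then show ?thesis by (metis abs_ge_zero power2_abs power_mono)
  qed
  have "scaled_norm_square p q x y b \<le> (1 / 2)\<^sup>2 + (1 / 2)\<^sup>2"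
    unfolding scaled_norm_square_def by (intro add_mono small) (auto simp: b_def assms)
  then have b: "1 \<le> b" "scaled_norm_square p q x y b \<le> 1"
    by (auto simp: b_def power2_eq_square)
  have "\<exists>\<rho>. a \<le> \<rho> \<and> \<rho> \<le> b \<and> scaled_norm_square p q x y \<rho> = 1"
    by (rule IVT2) (use a b in \<open>auto simp: scaled_norm_square_def intro!: continuous_intros\<close>)
  then obtain \<rho> where \<rho>: "0 < \<rho>" "scaled_norm_square p q x y \<rho> = 1"
    using less_le_trans[OF a(1)] by blast
  have "0 < weighted_radius p q x y \<and> scaled_norm_square p q x y (weighted_radius p q x y) = 1"
    unfolding weighted_radius_def
  proof (rule theI)
    show "0 < \<rho> \<and> scaled_norm_square p q x y \<rho> = 1" using \<rho> by simp
    fix \<sigma> assume "0 < \<sigma> \<and> scaled_norm_square p q x y \<sigma> = 1"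
    then show "\<sigma> = \<rho>"
      using \<rho> scaled_norm_square_strict_antimono[OF assms, of \<rho> \<sigma>]
        scaled_norm_square_strict_antimono[OF assms, of \<sigma> \<rho>] by (cases \<rho> \<sigma> rule: linorder_cases) auto
  qed
  then show "0 < weighted_radius p q x y" "scaled_norm_square p q x y (weighted_radius p q x y) = 1"
    by auto
qed

lemma less_weighted_radius_iff:
  assumes "0 < p" "0 < q" "(x, y) \<noteq> (0, 0)" "0 < \<rho>"
  shows "\<rho> < weighted_radius p q x y \<longleftrightarrow> 1 < scaled_norm_square p q x y \<rho>"
    and "weighted_radius p q x y < \<rho> \<longleftrightarrow> scaled_norm_square p q x y \<rho> < 1"
  using scaled_norm_square_strict_antimono[OF assms(1-4), of "weighted_radius p q x y"]
    scaled_norm_square_strict_antimono[OF assms(1-3) weighted_radius_pos[OF assms(1-3)], of \<rho>]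
    scaled_norm_square_radius[OF assms(1-3)]
  by (cases \<rho> "weighted_radius p q x y" rule: linorder_cases; force)+

text \<open>Comparing the radius with a constant amounts to a strict inequality for the scaled norm at that
  constant, and such an inequality persists nearby.\<close>

lemma continuous_on_weighted_radius:
  fixes x y :: "'a::topological_space \<Rightarrow> real"
  assumes pq: "0 < p" "0 < q" and x: "continuous_on S x" and y: "continuous_on S y"
    and nz: "\<And>t. t \<in> S \<Longrightarrow> (x t, y t) \<noteq> (0, 0)"
  shows "continuous_on S (\<lambda>t. weighted_radius p q (x t) (y t))"
  unfolding continuous_on_def
proof (intro ballI order_tendstoI)
  fix t a assume t: "t \<in> S"
  let ?r = "\<lambda>t. weighted_radius p q (x t) (y t)"
  have in_S: "\<forall>\<^sub>F s in at t within S. s \<in> S"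
    by (simp add: eventually_at_filter)
  have lim: "((\<lambda>t. scaled_norm_square p q (x t) (y t) a) \<longlongrightarrow> scaled_norm_square p q (x t) (y t) a) (at t within S)"
    if "0 < a" for a
    using x y t that unfolding scaled_norm_square_def continuous_on_def by (intro tendsto_intros) auto
  {
    assume a: "a < ?r t"
    show "\<forall>\<^sub>F s in at t within S. a < ?r s"
    proof (cases "0 < a")
      case True
      have "\<forall>\<^sub>F s in at t within S. 1 < scaled_norm_square p q (x s) (y s) a"
        using less_weighted_radius_iff(1)[OF pq nz[OF t] True] a
        by (intro order_tendstoD(1)[OF lim[OF True]]) simp
      with in_S show ?thesis
        by eventually_elim (simp add: less_weighted_radius_iff(1)[OF pq nz True])
    next
      case False
      from in_S show ?thesis
        by eventually_elim (use False in \<open>auto intro: le_less_trans[OF _ weighted_radius_pos[OF pq nz]]\<close>)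
    qed
  }
  {
    assume a: "?r t < a"
    then have a0: "0 < a" using weighted_radius_pos[OF pq nz[OF t]] by simp
    have "\<forall>\<^sub>F s in at t within S. scaled_norm_square p q (x s) (y s) a < 1"
      using less_weighted_radius_iff(2)[OF pq nz[OF t] a0] a
      by (intro order_tendstoD(2)[OF lim[OF a0]]) simp
    with in_S show "\<forall>\<^sub>F s in at t within S. ?r s < a"
      by eventually_elim (simp add: less_weighted_radius_iff(2)[OF pq nz a0])
  }
qed

text \<open>The angle of \<open>(a * cos \<theta>, b * sin \<theta>)\<close> for positive \<open>a\<close> and \<open>b\<close>, chosen continuously in \<open>\<theta>\<close>. That vector lies
  in the same quadrant as \<open>(cos \<theta>, sin \<theta>)\<close>, so the two angles differ by less than \<open>pi / 2\<close>, and the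
  difference is the arctangent of the quotient of their cross and scalar products.\<close>

definition weighted_angle :: "real \<Rightarrow> real \<Rightarrow> real \<Rightarrow> real" where
  "weighted_angle a b \<theta> =
     \<theta> + arctan ((b - a) * sin \<theta> * cos \<theta> / (a * (cos \<theta>)\<^sup>2 + b * (sin \<theta>)\<^sup>2))"

lemma weighted_square_sum_pos:
  fixes a b :: real
  assumes "0 < a" "0 < b"
  shows "0 < a * (cos \<theta>)\<^sup>2 + b * (sin \<theta>)\<^sup>2"
proof (cases "cos \<theta> = 0")
  case True
  then show ?thesis using assms sin_cos_squared_add[of \<theta>] by auto
next
  case False
  then show ?thesis using assms by (simp add: add_pos_nonneg)
qed

lemma cos_sin_weighted_angle:
  assumes ab: "0 < a" "0 < b" and 1: "(a * cos \<theta>)\<^sup>2 + (b * sin \<theta>)\<^sup>2 = 1"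
  shows "cos (weighted_angle a b \<theta>) = a * cos \<theta>" "sin (weighted_angle a b \<theta>) = b * sin \<theta>"
proof -
  define c s where "c = cos \<theta>" and "s = sin \<theta>"
  have cs: "c\<^sup>2 + s\<^sup>2 = 1" by (simp add: c_def s_def)
  define A B where "A = a * c\<^sup>2 + b * s\<^sup>2" and "B = (b - a) * s * c"
  have A: "0 < A" using weighted_square_sum_pos[OF ab] by (simp add: A_def c_def s_def)
  have "A\<^sup>2 + B\<^sup>2 = ((a * c)\<^sup>2 + (b * s)\<^sup>2) * (c\<^sup>2 + s\<^sup>2)"
    unfolding A_def B_def by algebra
  then have AB: "A\<^sup>2 + B\<^sup>2 = 1" using cs 1 by (simp add: c_def s_def)
  have "1 + (B / A)\<^sup>2 = (1 / A)\<^sup>2"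
    using A AB by (simp add: field_simps)
  then have "sqrt (1 + (B / A)\<^sup>2) = 1 / A" using A by (simp add: real_sqrt_abs)
  then have *: "cos (arctan (B / A)) = A" "sin (arctan (B / A)) = B"
    using A by (auto simp: cos_arctan sin_arctan)
  have w: "weighted_angle a b \<theta> = \<theta> + arctan (B / A)"
    by (simp add: weighted_angle_def A_def B_def c_def s_def)
  have "cos (weighted_angle a b \<theta>) = a * c * (c\<^sup>2 + s\<^sup>2)"
    unfolding w cos_add * unfolding c_def[symmetric] s_def[symmetric] A_def B_def by algebra
  then show "cos (weighted_angle a b \<theta>) = a * cos \<theta>" unfolding cs by (simp add: c_def)
  have "sin (weighted_angle a b \<theta>) = b * s * (c\<^sup>2 + s\<^sup>2)"
    unfolding w sin_add * unfolding c_def[symmetric] s_def[symmetric] A_def B_def by algebra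
  then show "sin (weighted_angle a b \<theta>) = b * sin \<theta>" unfolding cs by (simp add: s_def)
qed

text \<open>A path with a continuous ordinary polar angle \<open>\<theta>\<close> also has a continuous weighted polar angle. The two
  angles agree whenever the path meets the x-axis; hence a complete turn in \<open>\<theta>\<close> that starts
  there is a complete turn in \<open>\<phi>\<close>.\<close>

lemma weighted_polar_lift:
  fixes x y \<theta> :: "'a::t2_space \<Rightarrow> real"
  assumes pq: "0 < p" "0 < q"
    and cont: "continuous_on S x" "continuous_on S y" "continuous_on S \<theta>"
    and pol: "\<And>t. t \<in> S \<Longrightarrow> 0 < norm (x t, y t)"
      "\<And>t. t \<in> S \<Longrightarrow> x t = norm (x t, y t) * cos (\<theta> t)"
      "\<And>t. t \<in> S \<Longrightarrow> y t = norm (x t, y t) * sin (\<theta> t)"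
  obtains \<phi> \<rho> :: "'a \<Rightarrow> real" where "continuous_on S \<phi>" "continuous_on S \<rho>"
    "\<And>t. t \<in> S \<Longrightarrow> 0 < \<rho> t"
    "\<And>t. t \<in> S \<Longrightarrow> x t = \<rho> t ^ p * cos (\<phi> t)" "\<And>t. t \<in> S \<Longrightarrow> y t = \<rho> t ^ q * sin (\<phi> t)"
    "\<And>t. sin (\<theta> t) = 0 \<Longrightarrow> \<phi> t = \<theta> t"
proof -
  define \<rho> where "\<rho> t = weighted_radius p q (x t) (y t)" for t
  define a where "a t = norm (x t, y t) / \<rho> t ^ p" for t
  define b where "b t = norm (x t, y t) / \<rho> t ^ q" for t
  have nz: "(x t, y t) \<noteq> (0, 0)" if "t \<in> S" for t using pol(1)[OF that] by fastforce
  have \<rho>: "0 < \<rho> t" if "t \<in> S" for t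
    unfolding \<rho>_def by (rule weighted_radius_pos[OF pq nz[OF that]])
  have ab: "0 < a t" "0 < b t" if "t \<in> S" for t
    using pol(1)[OF that] \<rho>[OF that] by (simp_all add: a_def b_def)
  have cont_\<rho>: "continuous_on S \<rho>"
    unfolding \<rho>_def by (rule continuous_on_weighted_radius[OF pq cont(1,2) nz])
  have "continuous_on S a" "continuous_on S b"
    unfolding a_def b_def using \<rho> by (auto intro!: continuous_intros cont cont_\<rho> simp: less_imp_neq[symmetric])
  then have 1: "continuous_on S (\<lambda>t. weighted_angle (a t) (b t) (\<theta> t))"
    unfolding weighted_angle_def
    using weighted_square_sum_pos[OF ab]
    by (auto intro!: continuous_intros continuous_on_sin continuous_on_cos cont
        simp: less_imp_neq[symmetric])
  have x: "x t / \<rho> t ^ p = a t * cos (\<theta> t)" and y: "y t / \<rho> t ^ q = b t * sin (\<theta> t)" if "t \<in> S" for t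
    using pol(2,3)[OF that] by (simp_all add: a_def b_def)
  have *: "(a t * cos (\<theta> t))\<^sup>2 + (b t * sin (\<theta> t))\<^sup>2 = 1" if "t \<in> S" for t
    using scaled_norm_square_radius[OF pq nz[OF that]]
    unfolding scaled_norm_square_def \<rho>_def[symmetric] x[OF that] y[OF that] .
  show ?thesis
  proof (rule that[OF 1 cont_\<rho> \<rho>])
    fix t assume t: "t \<in> S"
    show "x t = \<rho> t ^ p * cos (weighted_angle (a t) (b t) (\<theta> t))"
      using cos_sin_weighted_angle(1)[OF ab[OF t] *[OF t]] x[OF t] \<rho>[OF t] by (simp add: field_simps)
    show "y t = \<rho> t ^ q * sin (weighted_angle (a t) (b t) (\<theta> t))"
      using cos_sin_weighted_angle(2)[OF ab[OF t] *[OF t]] y[OF t] \<rho>[OF t] by (simp add: field_simps)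
  qed (simp_all add: weighted_angle_def)
qed

text \<open>A continuous lift through a map with injective derivative inherits differentiability from the
  projected path. No local inverse of \<open>G\<close> is constructed: a left inverse \<open>B\<close> of the derivative turns
  the first-order expansions of \<open>G\<close> and of the projected path into one for the lift, in which the
  error term in the lift itself has a small coefficient and can be absorbed.\<close>

lemma has_derivative_lift:
  fixes \<gamma> :: "'c::real_normed_vector \<Rightarrow> 'a::real_normed_vector" and G :: "'a \<Rightarrow> 'b::real_normed_vector"
  assumes G: "(G has_derivative A) (at (\<gamma> t))"
    and B: "bounded_linear B" "\<And>h. B (A h) = h"
    and cont: "continuous (at t within S) \<gamma>"
    and D: "((\<lambda>s. G (\<gamma> s)) has_derivative D) (at t within S)"
  shows "(\<gamma> has_derivative (\<lambda>h. B (D h))) (at t within S)"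
  unfolding has_derivative_within_alt2
proof (intro conjI allI impI)
  have linD: "bounded_linear D" using D by (rule has_derivative_bounded_linear)
  show "bounded_linear (\<lambda>h. B (D h))" by (rule bounded_linear_compose[OF B(1) linD])
  fix e :: real assume e: "0 < e"
  obtain C where C: "0 < C" "\<And>z. norm (B z) \<le> norm z * C"
    using bounded_linear.pos_bounded[OF B(1)] by blast
  obtain L where L: "0 < L" "\<And>z. norm (D z) \<le> norm z * L"
    using bounded_linear.pos_bounded[OF linD] by blast
  \<comment> \<open>\<open>\<eta> \<le> 1 / 2\<close> allows absorption; the other bound makes the resulting error at most \<open>e\<close>\<close>
  define \<eta> where "\<eta> = min (1 / 2) (e / (2 * (C * L + 1)))"
  have CL: "0 < C * L + 1" using C L by (simp add: add_pos_pos)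
  have "\<eta> \<le> e / (2 * (C * L + 1))" by (simp add: \<eta>_def)
  then have "2 * \<eta> * (C * L + 1) \<le> e" using CL by (simp add: pos_le_divide_eq mult_ac)
  moreover have "0 < \<eta>" "\<eta> \<le> 1 / 2"
    using e CL by (simp add: \<eta>_def) (simp only: \<eta>_def min.cobounded1)
  ultimately have \<eta>: "0 < \<eta>" "\<eta> \<le> 1 / 2" "2 * \<eta> * (C * L + 1) \<le> e" by auto
  obtain d where d: "0 < d" "\<And>z. norm (z - \<gamma> t) < d \<Longrightarrow>
      norm (G z - G (\<gamma> t) - A (z - \<gamma> t)) \<le> \<eta> / C * norm (z - \<gamma> t)"
    using G \<eta> C unfolding has_derivative_at_alt by (meson divide_pos_pos)
  have "\<forall>\<^sub>F s in at t within S. norm (\<gamma> s - \<gamma> t) < d"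
    using tendstoD[OF cont[unfolded continuous_within] d(1)] by (simp add: dist_norm)
  moreover have "\<forall>\<^sub>F s in at t within S. norm (G (\<gamma> s) - G (\<gamma> t) - D (s - t)) \<le> \<eta> / C * norm (s - t)"
    using D \<eta> C unfolding has_derivative_within_alt2 by (meson divide_pos_pos)
  ultimately show "\<forall>\<^sub>F s in at t within S. norm (\<gamma> s - \<gamma> t - B (D (s - t))) \<le> e * norm (s - t)"
  proof eventually_elim
    fix s assume "norm (\<gamma> s - \<gamma> t) < d"
      and 2: "norm (G (\<gamma> s) - G (\<gamma> t) - D (s - t)) \<le> \<eta> / C * norm (s - t)"
    then have 1: "norm (G (\<gamma> s) - G (\<gamma> t) - A (\<gamma> s - \<gamma> t)) \<le> \<eta> / C * norm (\<gamma> s - \<gamma> t)"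
      by (intro d(2))
    let ?\<Delta> = "\<gamma> s - \<gamma> t" and ?g = "G (\<gamma> s) - G (\<gamma> t)"
    have "?\<Delta> - B (D (s - t)) = B (?g - D (s - t)) - B (?g - A ?\<Delta>)"
      using B(2)[of ?\<Delta>] by (simp add: bounded_linear.linear[OF B(1)] linear_diff)
    then have "norm (?\<Delta> - B (D (s - t))) = norm (B (?g - D (s - t)) - B (?g - A ?\<Delta>))"
      by (simp only:)
    also have "\<dots> \<le> norm (?g - D (s - t)) * C + norm (?g - A ?\<Delta>) * C"
      using C(2)[of "?g - D (s - t)"] C(2)[of "?g - A ?\<Delta>"]
        norm_triangle_ineq4[of "B (?g - D (s - t))" "B (?g - A ?\<Delta>)"] by linarith
    also have "\<dots> \<le> \<eta> / C * norm (s - t) * C + \<eta> / C * norm ?\<Delta> * C"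
      using 1 2 C(1) by (intro add_mono mult_right_mono) auto
    also have "\<dots> = \<eta> * norm (s - t) + \<eta> * norm ?\<Delta>" using C(1) by simp
    finally have E: "norm (?\<Delta> - B (D (s - t))) \<le> \<eta> * norm (s - t) + \<eta> * norm ?\<Delta>" .
    have "norm (B (D (s - t))) \<le> norm (D (s - t)) * C" by (rule C(2))
    also have "\<dots> \<le> norm (s - t) * L * C" using C(1) L(2) by (intro mult_right_mono) auto
    finally have "norm ?\<Delta> \<le> norm (?\<Delta> - B (D (s - t))) + C * L * norm (s - t)"
      using norm_triangle_sub[of ?\<Delta> "B (D (s - t))"] by (simp add: mult_ac)
    then have "\<eta> * norm ?\<Delta> \<le> \<eta> * norm (?\<Delta> - B (D (s - t))) + \<eta> * (C * L * norm (s - t))"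
      using \<eta>(1) by (simp flip: distrib_left)
    moreover have "\<eta> * norm (?\<Delta> - B (D (s - t))) \<le> 1 / 2 * norm (?\<Delta> - B (D (s - t)))"
      using \<eta>(2) by (intro mult_right_mono) auto
    ultimately have "norm (?\<Delta> - B (D (s - t))) \<le> 2 * \<eta> * (C * L + 1) * norm (s - t)"
      using E by (simp add: algebra_simps)
    also have "\<dots> \<le> e * norm (s - t)" using \<eta>(3) by (intro mult_right_mono) auto
    finally show "norm (?\<Delta> - B (D (s - t))) \<le> e * norm (s - t)" .
  qed
qed

text \<open>Solving \<open>x' = X\<close>, \<open>y' = Y\<close> for \<open>\<phi>'\<close> and \<open>\<rho>'\<close> by Cramer's rule. The common denominator \<open>K\<close> is \<open>\<rho>\<close>
  times the Jacobian determinant of the weighted polar coordinates.\<close>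

lemma weighted_polar_derivatives:
  fixes \<phi> \<rho> :: "real \<Rightarrow> real"
  assumes pq: "0 < p" "0 < q" and t: "t \<in> S" and \<rho>: "0 < \<rho> t"
    and cont: "continuous_on S \<phi>" "continuous_on S \<rho>"
    and x: "\<And>s. s \<in> S \<Longrightarrow> x s = \<rho> s ^ p * cos (\<phi> s)" "(x has_real_derivative X) (at t within S)"
    and y: "\<And>s. s \<in> S \<Longrightarrow> y s = \<rho> s ^ q * sin (\<phi> s)" "(y has_real_derivative Y) (at t within S)"
  defines "K \<equiv> \<rho> t ^ (p + q) * (real p * (cos (\<phi> t))\<^sup>2 + real q * (sin (\<phi> t))\<^sup>2)"
  shows "(\<phi> has_real_derivative
      (real p * \<rho> t ^ p * cos (\<phi> t) * Y - real q * \<rho> t ^ q * sin (\<phi> t) * X) / K) (at t within S)"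
    and "(\<rho> has_real_derivative
      \<rho> t * (\<rho> t ^ q * cos (\<phi> t) * X + \<rho> t ^ p * sin (\<phi> t) * Y) / K) (at t within S)"
proof -
  define c s r where "c = cos (\<phi> t)" and "s = sin (\<phi> t)" and "r = \<rho> t"
  let ?G = "\<lambda>z. (snd z ^ p * cos (fst z), snd z ^ q * sin (fst z)) :: real \<times> real"
  let ?A = "\<lambda>(h, k). (real p * r ^ (p - 1) * c * k - r ^ p * s * h,
    real q * r ^ (q - 1) * s * k + r ^ q * c * h)"
  let ?B = "\<lambda>(X, Y). ((real p * r ^ p * c * Y - real q * r ^ q * s * X) / K,
    r * (r ^ q * c * X + r ^ p * s * Y) / K)"
  obtain m n where m: "p = Suc m" and n: "q = Suc n" using pq by (metis gr0_implies_Suc)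
  have r: "0 < r" using \<rho> by (simp add: r_def)
  have K: "K = r ^ (p + q) * (real p * c\<^sup>2 + real q * s\<^sup>2)" by (simp add: K_def r_def c_def s_def)
  have D0: "0 < real p * c\<^sup>2 + real q * s\<^sup>2"
    unfolding c_def s_def by (rule weighted_square_sum_pos) (use pq in auto)
  then have K0: "K \<noteq> 0" using r by (simp add: K)
  have G: "(?G has_derivative ?A) (at (\<phi> t, \<rho> t))"
    unfolding split_def c_def s_def r_def
    by (rule derivative_eq_intros refl | (simp add: algebra_simps; fail))+
  have BA: "?B (?A z) = z" for z
  proof -
    obtain h k where z: "z = (h, k)" by fastforce
    have "(real p * r ^ p * c * (real q * r ^ (q - 1) * s * k + r ^ q * c * h)
        - real q * r ^ q * s * (real p * r ^ (p - 1) * c * k - r ^ p * s * h)) = K * h"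
      unfolding K m n by (simp add: power_add power2_eq_square algebra_simps)
    moreover have "r * (r ^ q * c * (real p * r ^ (p - 1) * c * k - r ^ p * s * h)
        + r ^ p * s * (real q * r ^ (q - 1) * s * k + r ^ q * c * h)) = K * k"
      unfolding K m n by (simp add: power_add power2_eq_square algebra_simps)
    ultimately show ?thesis using K0 by (simp add: z)
  qed
  have "bounded_linear ?B"
    unfolding split_def by (intro bounded_linear_intros bounded_linear_divide[THEN bounded_linear_compose])
  moreover have "continuous (at t within S) (\<lambda>s. (\<phi> s, \<rho> s))"
    using cont t by (auto simp: continuous_on_eq_continuous_within intro!: continuous_Pair)
  moreover have "((\<lambda>s. ?G (\<phi> s, \<rho> s)) has_derivative (\<lambda>h. (X * h, Y * h))) (at t within S)"
  proof (rule has_derivative_transform[OF t])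
    show "((\<lambda>s. (x s, y s)) has_derivative (\<lambda>h. (X * h, Y * h))) (at t within S)"
      using x(2) y(2) by (auto simp: has_field_derivative_def intro!: derivative_intros)
  qed (use x(1) y(1) in auto)
  ultimately have lift: "((\<lambda>s. (\<phi> s, \<rho> s)) has_derivative (\<lambda>h. ?B (X * h, Y * h))) (at t within S)"
    using has_derivative_lift[where \<gamma> = "\<lambda>s. (\<phi> s, \<rho> s)", OF G _ BA] by blast
  have "(\<phi> has_derivative (\<lambda>h. fst (?B (X * h, Y * h)))) (at t within S)"
    using has_derivative_fst[OF lift] by simp
  then show "(\<phi> has_real_derivative
      (real p * \<rho> t ^ p * cos (\<phi> t) * Y - real q * \<rho> t ^ q * sin (\<phi> t) * X) / K) (at t within S)"
    unfolding has_field_derivative_def c_def s_def r_def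
    by (rule has_derivative_eq_rhs) (simp add: fun_eq_iff algebra_simps diff_divide_distrib)
  have "(\<rho> has_derivative (\<lambda>h. snd (?B (X * h, Y * h)))) (at t within S)"
    using has_derivative_snd[OF lift] by simp
  then show "(\<rho> has_real_derivative
      \<rho> t * (\<rho> t ^ q * cos (\<phi> t) * X + \<rho> t ^ p * sin (\<phi> t) * Y) / K) (at t within S)"
    unfolding has_field_derivative_def c_def s_def r_def
    by (rule has_derivative_eq_rhs) (simp add: fun_eq_iff algebra_simps add_divide_distrib)
qed

section \<open>Regularity of the polar equation\<close>

text \<open>\<open>\<Theta>\<close> and \<open>R\<close> multiplied by the common positive factor that clears all negative powers of \<open>\<rho>\<close> and the
  leading degree. For \<open>\<rho> > 0\<close> this changes neither the quotient \<open>F\<close> nor the zeros of \<open>\<Theta>\<close>.\<close>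

definition angular_numerator ::
  "(real \<Rightarrow> real \<Rightarrow> real) \<Rightarrow> (real \<Rightarrow> real \<Rightarrow> real) \<Rightarrow> nat \<Rightarrow> nat \<Rightarrow> real \<Rightarrow> real \<Rightarrow> real" where
  "angular_numerator P Q p q \<phi> \<rho> =
     real p * \<rho> ^ p * cos \<phi> * Q (\<rho> ^ p * cos \<phi>) (\<rho> ^ q * sin \<phi>)
       - real q * \<rho> ^ q * sin \<phi> * P (\<rho> ^ p * cos \<phi>) (\<rho> ^ q * sin \<phi>)"

definition radial_numerator ::
  "(real \<Rightarrow> real \<Rightarrow> real) \<Rightarrow> (real \<Rightarrow> real \<Rightarrow> real) \<Rightarrow> nat \<Rightarrow> nat \<Rightarrow> real \<Rightarrow> real \<Rightarrow> real" where
  "radial_numerator P Q p q \<phi> \<rho> =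
     \<rho> * (\<rho> ^ q * cos \<phi> * P (\<rho> ^ p * cos \<phi>) (\<rho> ^ q * sin \<phi>)
       + \<rho> ^ p * sin \<phi> * Q (\<rho> ^ p * cos \<phi>) (\<rho> ^ q * sin \<phi>))"

lemma polar_in_numerators:
  assumes pq: "0 < p" "0 < q" and \<rho>: "0 < \<rho>"
  shows polar_Theta_eq_0_iff: "polar_Theta P Q p q \<phi> \<rho> = 0 \<longleftrightarrow> angular_numerator P Q p q \<phi> \<rho> = 0"
    and polar_F_eq: "polar_F P Q p q \<phi> \<rho> = radial_numerator P Q p q \<phi> \<rho> / angular_numerator P Q p q \<phi> \<rho>"
proof -
  define K where "K = \<rho> ^ (p + q) * (real p * (cos \<phi>)\<^sup>2 + real q * (sin \<phi>)\<^sup>2) * \<rho> powi leading_degree p q P Q"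
  have D: "0 < real p * (cos \<phi>)\<^sup>2 + real q * (sin \<phi>)\<^sup>2"
    by (rule weighted_square_sum_pos) (use pq in auto)
  then have K: "K \<noteq> 0" using \<rho> by (simp add: K_def)
  have inv: "\<rho> powi (- int n) = 1 / \<rho> ^ n" "\<rho> powi (1 - int n) = \<rho> / \<rho> ^ n" for n
    using \<rho> by (simp_all add: power_int_minus power_int_diff inverse_eq_divide)
  have T: "polar_Theta P Q p q \<phi> \<rho> = angular_numerator P Q p q \<phi> \<rho> / K"
    using \<rho> D unfolding polar_Theta_def angular_numerator_def K_def Let_def inv
    by (simp add: power_add divide_simps)
  have R: "polar_R P Q p q \<phi> \<rho> = radial_numerator P Q p q \<phi> \<rho> / K"
    using \<rho> D unfolding polar_R_def radial_numerator_def K_def Let_def inv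
    by (simp add: power_add divide_simps) (simp add: algebra_simps)
  show "polar_Theta P Q p q \<phi> \<rho> = 0 \<longleftrightarrow> angular_numerator P Q p q \<phi> \<rho> = 0"
    using K by (simp add: T)
  show "polar_F P Q p q \<phi> \<rho> = radial_numerator P Q p q \<phi> \<rho> / angular_numerator P Q p q \<phi> \<rho>"
    using K by (simp add: polar_F_def T R)
qed

lemma weighted_polar_in_ball:
  assumes "0 < p" "0 < q" "0 < \<rho>" "\<rho> < \<delta>" "\<delta> \<le> 1"
  shows "(\<rho> ^ p * cos \<phi>, \<rho> ^ q * sin \<phi>) \<in> ball 0 \<delta>"
proof -
  have pow: "\<rho> ^ n \<le> \<rho>" if "0 < n" for n
    using power_decreasing[of 1 n \<rho>] that assms by simp
  have "(\<rho> ^ p * cos \<phi>)\<^sup>2 + (\<rho> ^ q * sin \<phi>)\<^sup>2 \<le> \<rho>\<^sup>2 * (cos \<phi>)\<^sup>2 + \<rho>\<^sup>2 * (sin \<phi>)\<^sup>2"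
    unfolding power_mult_distrib using assms
    by (intro add_mono mult_right_mono power_mono pow) auto
  also have "\<dots> = \<rho>\<^sup>2" by (simp flip: distrib_left)
  finally have "norm (\<rho> ^ p * cos \<phi>, \<rho> ^ q * sin \<phi>) \<le> \<rho>"
    using assms by (simp add: norm_Pair real_le_lsqrt)
  then show ?thesis using assms by simp
qed

text \<open>If \<open>\<rho>\<close> were at least \<open>\<epsilon>\<close>, then both \<open>\<bar>cos \<phi>\<bar>\<close> and \<open>\<bar>sin \<phi>\<bar>\<close> would be at most one half.\<close>

lemma weighted_radius_small:
  assumes "0 < \<epsilon>" "norm (\<rho> ^ p * cos \<phi>, \<rho> ^ q * sin \<phi>) < min (\<epsilon> ^ p) (\<epsilon> ^ q) / 2"
  shows "\<rho> < \<epsilon>"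
proof (rule ccontr)
  assume "\<not> \<rho> < \<epsilon>"
  then have \<rho>: "\<epsilon> \<le> \<rho>" "0 < \<rho>" using assms by auto
  have half: "\<bar>c\<bar> \<le> 1 / 2" if "\<bar>\<rho> ^ n * c\<bar> \<le> \<epsilon> ^ n / 2" for c :: real and n
  proof -
    have "\<epsilon> ^ n \<le> \<rho> ^ n" using \<rho> assms by (intro power_mono) auto
    then have "\<epsilon> ^ n / 2 \<le> \<rho> ^ n * (1 / 2)" by simp
    with that have "\<bar>\<rho> ^ n * c\<bar> \<le> \<rho> ^ n * (1 / 2)" by (rule order_trans)
    then have "\<rho> ^ n * \<bar>c\<bar> \<le> \<rho> ^ n * (1 / 2)" using \<rho>(2) by (simp only: abs_mult power_abs abs_of_pos)
    then show ?thesis by (rule mult_left_le_imp_le) (use \<rho> in simp)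
  qed
  have "\<bar>cos \<phi>\<bar> \<le> 1 / 2" "\<bar>sin \<phi>\<bar> \<le> 1 / 2"
    using half[of p "cos \<phi>"] half[of q "sin \<phi>"] assms(2)
      norm_fst_le[of "\<rho> ^ p * cos \<phi>" "\<rho> ^ q * sin \<phi>"] norm_snd_le[of "\<rho> ^ q * sin \<phi>" "\<rho> ^ p * cos \<phi>"]
    by auto
  then have "\<bar>cos \<phi>\<bar>\<^sup>2 \<le> (1 / 2)\<^sup>2" "\<bar>sin \<phi>\<bar>\<^sup>2 \<le> (1 / 2)\<^sup>2"
    by (intro power_mono; simp)+
  then show False using sin_cos_squared_add[of \<phi>] by (simp add: power2_eq_square)
qed

lemma weighted_polar_chain_rule:
  fixes f :: "real \<Rightarrow> real \<Rightarrow> real" and p q :: nat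
  defines "z \<equiv> \<lambda>\<phi> \<rho>. (\<rho> ^ p * cos \<phi>, \<rho> ^ q * sin \<phi>)"
  assumes f: "((\<lambda>(x, y). f x y) has_derivative (\<lambda>(h, k). fx (z \<phi> \<rho>) * h + fy (z \<phi> \<rho>) * k)) (at (z \<phi> \<rho>))"
  shows "((\<lambda>\<rho>. f (\<rho> ^ p * cos \<phi>) (\<rho> ^ q * sin \<phi>)) has_real_derivative
    fx (z \<phi> \<rho>) * (real p * \<rho> ^ (p - 1) * cos \<phi>) + fy (z \<phi> \<rho>) * (real q * \<rho> ^ (q - 1) * sin \<phi>)) (at \<rho>)"
proof -
  have "((\<lambda>\<rho>. z \<phi> \<rho>) has_derivative
      (\<lambda>h. (real p * \<rho> ^ (p - 1) * cos \<phi> * h, real q * \<rho> ^ (q - 1) * sin \<phi> * h))) (at \<rho>)"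
    unfolding z_def by (rule derivative_eq_intros refl | (simp add: algebra_simps; fail))+
  from has_derivative_compose[OF this, of "\<lambda>(x, y). f x y", OF f]
  have "((\<lambda>\<rho>. f (\<rho> ^ p * cos \<phi>) (\<rho> ^ q * sin \<phi>)) has_derivative
      (\<lambda>h. fx (z \<phi> \<rho>) * (real p * \<rho> ^ (p - 1) * cos \<phi> * h)
        + fy (z \<phi> \<rho>) * (real q * \<rho> ^ (q - 1) * sin \<phi> * h))) (at \<rho>)"
    by (simp add: z_def)
  then show ?thesis
    unfolding has_field_derivative_def by (rule has_derivative_eq_rhs) (simp add: fun_eq_iff algebra_simps)
qed

text \<open>Off \<open>\<rho> = 0\<close> the polar equation inherits its regularity from the field by the chain and quotient
  rules.\<close>

lemma polar_quotient_C1: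
  assumes pq: "0 < p" "0 < q" and \<delta>: "\<delta> \<le> 1"
    and P: "\<And>z. z \<in> ball 0 \<delta> \<Longrightarrow> ((\<lambda>(x, y). P x y) has_derivative (\<lambda>(h, k). Px z * h + Py z * k)) (at z)"
    and Q: "\<And>z. z \<in> ball 0 \<delta> \<Longrightarrow> ((\<lambda>(x, y). Q x y) has_derivative (\<lambda>(h, k). Qx z * h + Qy z * k)) (at z)"
    and cont: "continuous_on (ball 0 \<delta>) Px" "continuous_on (ball 0 \<delta>) Py"
      "continuous_on (ball 0 \<delta>) Qx" "continuous_on (ball 0 \<delta>) Qy"
  shows continuous_on_angular_numerator:
      "continuous_on (UNIV \<times> {0<..<\<delta>}) (\<lambda>(\<phi>, \<rho>). angular_numerator P Q p q \<phi> \<rho>)"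
    and polar_F_C1: "(\<And>\<phi> \<rho>. 0 < \<rho> \<Longrightarrow> \<rho> < \<delta> \<Longrightarrow> angular_numerator P Q p q \<phi> \<rho> \<noteq> 0) \<Longrightarrow>
      \<exists>F1. (\<forall>\<phi>. \<forall>\<rho>\<in>{0<..<\<delta>}. (polar_F P Q p q \<phi> has_real_derivative F1 \<phi> \<rho>) (at \<rho>)) \<and>
        continuous_on (UNIV \<times> {0<..<\<delta>}) (\<lambda>(\<phi>, \<rho>). F1 \<phi> \<rho>)"
proof -
  let ?z = "\<lambda>\<phi> \<rho>. (\<rho> ^ p * cos \<phi>, \<rho> ^ q * sin \<phi>)"
  let ?S = "UNIV \<times> {0<..<\<delta>} :: (real \<times> real) set"
  have z: "?z \<phi> \<rho> \<in> ball 0 \<delta>" if "0 < \<rho>" "\<rho> < \<delta>" for \<phi> \<rho>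
    by (rule weighted_polar_in_ball) (use pq \<delta> that in auto)
  have comp: "continuous_on ?S (\<lambda>w. f (?z (fst w) (snd w)))"
    if "continuous_on (ball 0 \<delta>) f" for f :: "real \<times> real \<Rightarrow> real"
    by (rule continuous_on_compose2[OF that]) (use z in \<open>auto intro!: continuous_intros\<close>)
  have "continuous_on (ball 0 \<delta>) (\<lambda>(x, y). P x y)" "continuous_on (ball 0 \<delta>) (\<lambda>(x, y). Q x y)"
    using P Q by (auto simp: continuous_on_eq_continuous_at intro!: has_derivative_continuous)
  then have cP: "continuous_on ?S (\<lambda>w. P (snd w ^ p * cos (fst w)) (snd w ^ q * sin (fst w)))"
    and cQ: "continuous_on ?S (\<lambda>w. Q (snd w ^ p * cos (fst w)) (snd w ^ q * sin (fst w)))"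
    using comp[of "\<lambda>(x, y). P x y"] comp[of "\<lambda>(x, y). Q x y"] by auto
  let ?x = "\<lambda>\<phi> \<rho>. real p * \<rho> ^ (p - 1) * cos \<phi>" and ?y = "\<lambda>\<phi> \<rho>. real q * \<rho> ^ (q - 1) * sin \<phi>"
  define P1 where "P1 \<phi> \<rho> = Px (?z \<phi> \<rho>) * ?x \<phi> \<rho> + Py (?z \<phi> \<rho>) * ?y \<phi> \<rho>" for \<phi> \<rho>
  define Q1 where "Q1 \<phi> \<rho> = Qx (?z \<phi> \<rho>) * ?x \<phi> \<rho> + Qy (?z \<phi> \<rho>) * ?y \<phi> \<rho>" for \<phi> \<rho>
  have cP1: "continuous_on ?S (\<lambda>w. P1 (fst w) (snd w))" and cQ1: "continuous_on ?S (\<lambda>w. Q1 (fst w) (snd w))"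
    unfolding P1_def Q1_def by (intro continuous_intros comp cont)+
  show cA: "continuous_on ?S (\<lambda>(\<phi>, \<rho>). angular_numerator P Q p q \<phi> \<rho>)"
    unfolding split_def angular_numerator_def by (intro continuous_intros cP cQ)
  assume nz: "\<And>\<phi> \<rho>. 0 < \<rho> \<Longrightarrow> \<rho> < \<delta> \<Longrightarrow> angular_numerator P Q p q \<phi> \<rho> \<noteq> 0"
  define A1 where "A1 \<phi> \<rho> =
      real p * (real p * \<rho> ^ (p - 1)) * cos \<phi> * Q (\<rho> ^ p * cos \<phi>) (\<rho> ^ q * sin \<phi>)
      + real p * \<rho> ^ p * cos \<phi> * Q1 \<phi> \<rho>
      - (real q * (real q * \<rho> ^ (q - 1)) * sin \<phi> * P (\<rho> ^ p * cos \<phi>) (\<rho> ^ q * sin \<phi>)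
      + real q * \<rho> ^ q * sin \<phi> * P1 \<phi> \<rho>)" for \<phi> \<rho>
  define R1 where "R1 \<phi> \<rho> =
      (\<rho> ^ q * cos \<phi> * P (\<rho> ^ p * cos \<phi>) (\<rho> ^ q * sin \<phi>)
       + \<rho> ^ p * sin \<phi> * Q (\<rho> ^ p * cos \<phi>) (\<rho> ^ q * sin \<phi>))
      + \<rho> * (real q * \<rho> ^ (q - 1) * cos \<phi> * P (\<rho> ^ p * cos \<phi>) (\<rho> ^ q * sin \<phi>)
      + \<rho> ^ q * cos \<phi> * P1 \<phi> \<rho>
      + (real p * \<rho> ^ (p - 1) * sin \<phi> * Q (\<rho> ^ p * cos \<phi>) (\<rho> ^ q * sin \<phi>)
      + \<rho> ^ p * sin \<phi> * Q1 \<phi> \<rho>))" for \<phi> \<rho>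
  let ?A = "angular_numerator P Q p q" and ?R = "radial_numerator P Q p q"
  define F1 where "F1 \<phi> \<rho> = (R1 \<phi> \<rho> * ?A \<phi> \<rho> - ?R \<phi> \<rho> * A1 \<phi> \<rho>) / (?A \<phi> \<rho>)\<^sup>2" for \<phi> \<rho>
  have "(polar_F P Q p q \<phi> has_real_derivative F1 \<phi> \<rho>) (at \<rho>)" if \<rho>: "\<rho> \<in> {0<..<\<delta>}" for \<phi> \<rho>
  proof -
    have dP: "((\<lambda>\<rho>. P (\<rho> ^ p * cos \<phi>) (\<rho> ^ q * sin \<phi>)) has_real_derivative P1 \<phi> \<rho>) (at \<rho>)"
      unfolding P1_def by (rule weighted_polar_chain_rule[where f = P and fx = Px and fy = Py, OF P]) (use z \<rho> in auto)
    have dQ: "((\<lambda>\<rho>. Q (\<rho> ^ p * cos \<phi>) (\<rho> ^ q * sin \<phi>)) has_real_derivative Q1 \<phi> \<rho>) (at \<rho>)"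
      unfolding Q1_def by (rule weighted_polar_chain_rule[where f = Q and fx = Qx and fy = Qy, OF Q]) (use z \<rho> in auto)
    have dA: "(?A \<phi> has_real_derivative A1 \<phi> \<rho>) (at \<rho>)"
      unfolding angular_numerator_def[abs_def] A1_def
      by (rule derivative_eq_intros dP dQ refl | (simp add: algebra_simps; fail))+
    have dR: "(?R \<phi> has_real_derivative R1 \<phi> \<rho>) (at \<rho>)"
      unfolding radial_numerator_def[abs_def] R1_def
      by (rule derivative_eq_intros dP dQ refl | (simp add: algebra_simps; fail))+
    have "((\<lambda>\<rho>. ?R \<phi> \<rho> / ?A \<phi> \<rho>) has_real_derivative F1 \<phi> \<rho>) (at \<rho>)"
      using DERIV_divide[OF dR dA] nz \<rho> by (simp add: F1_def power2_eq_square)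
    then show ?thesis
      by (rule has_field_derivative_transform_within_open[of _ _ _ "{0<..<\<delta>}"])
        (use \<rho> pq in \<open>auto simp: polar_F_eq\<close>)
  qed
  moreover have "continuous_on ?S (\<lambda>(\<phi>, \<rho>). F1 \<phi> \<rho>)"
    unfolding split_def F1_def A1_def R1_def radial_numerator_def
    by (intro continuous_intros cP cQ cP1 cQ1 cA[unfolded split_def]) (use nz in auto)
  ultimately show "\<exists>F1. (\<forall>\<phi>. \<forall>\<rho>\<in>{0<..<\<delta>}. (polar_F P Q p q \<phi> has_real_derivative F1 \<phi> \<rho>) (at \<rho>)) \<and>
        continuous_on ?S (\<lambda>(\<phi>, \<rho>). F1 \<phi> \<rho>)" by blast
qed

section \<open>Solutions over a full turn\<close>

lemma nonvanishing_constant_sign: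
  fixes f :: "'a::topological_space \<Rightarrow> real"
  assumes "connected S" "continuous_on S f" "\<And>z. z \<in> S \<Longrightarrow> f z \<noteq> 0"
  shows "(\<forall>z\<in>S. 0 < f z) \<or> (\<forall>z\<in>S. f z < 0)"
proof (rule ccontr)
  assume "\<not> ?thesis"
  then obtain z w where "z \<in> S" "f z \<le> 0" "w \<in> S" "0 \<le> f w" by force
  then have "0 \<in> f ` S"
    using connected_continuous_image[OF assms(2,1)] unfolding connected_iff_interval by blast
  then show False using assms(3) by auto
qed

text \<open>Eliminating time: a coordinate \<open>\<phi>\<close> with positive derivative can be used as the independent variable,
  also at the end points, where the derivatives are one-sided.\<close>

lemma increasing_reparametrization:
  fixes \<phi> \<rho> \<phi>' \<rho>' :: "real \<Rightarrow> real"
  assumes T: "0 < T"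
    and \<phi>: "\<And>t. t \<in> {0..T} \<Longrightarrow> (\<phi> has_real_derivative \<phi>' t) (at t within {0..T})"
    and pos: "\<And>t. t \<in> {0..T} \<Longrightarrow> 0 < \<phi>' t"
    and \<rho>: "\<And>t. t \<in> {0..T} \<Longrightarrow> (\<rho> has_real_derivative \<rho>' t) (at t within {0..T})"
  obtains u where "\<phi> 0 < \<phi> T" "\<And>t. t \<in> {0..T} \<Longrightarrow> u (\<phi> t) = \<rho> t" "\<phi> ` {0..T} = {\<phi> 0..\<phi> T}"
    "\<And>t. t \<in> {0..T} \<Longrightarrow> (u has_real_derivative \<rho>' t / \<phi>' t) (at (\<phi> t) within {\<phi> 0..\<phi> T})"
proof -
  have cont: "continuous_on {0..T} \<phi>"
    by (rule DERIV_continuous_on[OF \<phi>])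
  have mono: "\<phi> s < \<phi> t" if "0 \<le> s" "s < t" "t \<le> T" for s t
  proof (rule DERIV_pos_imp_increasing_open[OF that(2)])
    fix r assume r: "s < r" "r < t"
    then have "(\<phi> has_real_derivative \<phi>' r) (at r)"
      using \<phi>[of r] that at_within_Icc_at[of 0 r T] by auto
    then show "\<exists>y. (\<phi> has_real_derivative y) (at r) \<and> 0 < y" using pos[of r] r that by auto
  qed (use that in \<open>auto intro: continuous_on_subset[OF cont]\<close>)
  then have inj: "inj_on \<phi> {0..T}"
    by (intro inj_onI) (metis atLeastAtMost_iff less_irrefl linorder_neqE)
  have image: "\<phi> ` {0..T} = {\<phi> 0..\<phi> T}"
  proof
    show "\<phi> ` {0..T} \<subseteq> {\<phi> 0..\<phi> T}"
      using mono by (auto simp: le_less)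
    show "{\<phi> 0..\<phi> T} \<subseteq> \<phi> ` {0..T}"
      using IVT'[OF _ _ _ cont] T by (force simp: image_iff)
  qed
  define g where "g = the_inv_into {0..T} \<phi>"
  have g: "g (\<phi> t) = t" if "t \<in> {0..T}" for t
    unfolding g_def by (rule the_inv_into_f_f[OF inj that])
  have cont_g: "continuous_on (\<phi> ` {0..T}) g"
    by (rule continuous_on_inv[OF cont]) (use g in auto)
  have "((\<lambda>s. \<rho> (g s)) has_real_derivative \<rho>' t / \<phi>' t) (at (\<phi> t) within {\<phi> 0..\<phi> T})" if t: "t \<in> {0..T}" for t
  proof -
    have "(g has_derivative (*) (1 / \<phi>' t)) (at (\<phi> t) within \<phi> ` {0..T})"
    proof (rule has_derivative_inverse_within[OF \<phi>[OF t, unfolded has_field_derivative_def] _ t _ _ g])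
      show "continuous (at (\<phi> t) within \<phi> ` {0..T}) g"
        using cont_g t by (auto simp: continuous_on_eq_continuous_within)
      show "(*) (1 / \<phi>' t) \<circ> (*) (\<phi>' t) = id" using pos[OF t] by (auto simp: fun_eq_iff)
    qed (auto intro: linear_times)
    then have dg: "(g has_real_derivative 1 / \<phi>' t) (at (\<phi> t) within \<phi> ` {0..T})"
      by (simp add: has_field_derivative_def)
    have "g ` \<phi> ` {0..T} = {0..T}" using g by force
    then have "(\<rho> has_real_derivative \<rho>' t) (at (g (\<phi> t)) within g ` \<phi> ` {0..T})"
      using \<rho>[OF t] by (simp add: g[OF t])
    from DERIV_image_chain[OF this dg] show ?thesis by (simp add: o_def image)
  qed
  then show ?thesis using that[of "\<lambda>s. \<rho> (g s)"] mono[of 0 T] T g image by auto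
qed

text \<open>An orbit starting on the positive x-axis and making a complete turn in a small disc, written in
  weighted polar coordinates, is a solution of the polar equation over \<open>[0, 2 * pi]\<close>. The factor \<open>\<sigma>\<close>
  stands for the direction of time: it is chosen such that the weighted angle increases along the orbit, and it
  cancels in the quotient of the two velocities. A full turn prescribes only the absolute value of
  the total angle; the monotonicity of \<open>\<phi>\<close> decides its sign.\<close>

lemma full_turn_imp_polar_solution:
  assumes pq: "0 < p" "0 < q" and \<rho>0: "0 < \<rho>0" and \<epsilon>: "0 < \<epsilon>"
    and turn: "full_turn (\<lambda>x y. \<sigma> * P x y) (\<lambda>x y. \<sigma> * Q x y) (min (\<epsilon> ^ p) (\<epsilon> ^ q) / 2) (\<rho>0 ^ p, 0)"
    and sign: "\<And>\<phi> \<rho>. 0 < \<rho> \<Longrightarrow> \<rho> < \<epsilon> \<Longrightarrow> 0 < \<sigma> * angular_numerator P Q p q \<phi> \<rho>"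
  shows "\<exists>u. polar_solution P Q p q \<epsilon> \<rho>0 u"
proof -
  obtain T x y \<alpha> where T: "0 < T" and init: "x 0 = \<rho>0 ^ p" "y 0 = 0"
    and cont_\<alpha>: "continuous_on {0..T} \<alpha>" and turn: "\<bar>\<alpha> T - \<alpha> 0\<bar> = 2 * pi"
    and orbit: "\<And>t. t \<in> {0..T} \<Longrightarrow> 0 < norm (x t, y t)"
      "\<And>t. t \<in> {0..T} \<Longrightarrow> norm (x t, y t) < min (\<epsilon> ^ p) (\<epsilon> ^ q) / 2"
      "\<And>t. t \<in> {0..T} \<Longrightarrow> (x has_real_derivative \<sigma> * P (x t) (y t)) (at t within {0..T})"
      "\<And>t. t \<in> {0..T} \<Longrightarrow> (y has_real_derivative \<sigma> * Q (x t) (y t)) (at t within {0..T})"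
      "\<And>t. t \<in> {0..T} \<Longrightarrow> x t = norm (x t, y t) * cos (\<alpha> t)"
      "\<And>t. t \<in> {0..T} \<Longrightarrow> y t = norm (x t, y t) * sin (\<alpha> t)"
    using turn unfolding full_turn_def by auto
  have 0: "cos (\<alpha> 0) = 1" "sin (\<alpha> 0) = 0"
    using orbit(1)[of 0] orbit(5)[of 0] orbit(6)[of 0] T init \<rho>0 by (auto simp: norm_Pair)
  \<comment> \<open>normalise the angle to start at zero, so that its weighted counterpart starts at zero as well\<close>
  define \<theta> where "\<theta> t = \<alpha> t - \<alpha> 0" for t
  have trig: "cos (\<theta> t) = cos (\<alpha> t)" "sin (\<theta> t) = sin (\<alpha> t)" for t
    using 0 by (simp_all add: \<theta>_def cos_diff sin_diff)
  have cx: "continuous_on {0..T} x" and cy: "continuous_on {0..T} y"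
    by (rule DERIV_continuous_on[OF orbit(3)], assumption) (rule DERIV_continuous_on[OF orbit(4)])
  have c\<theta>: "continuous_on {0..T} \<theta>" unfolding \<theta>_def by (intro continuous_intros cont_\<alpha>)
  obtain \<phi> \<rho> where lift: "continuous_on {0..T} \<phi>" "continuous_on {0..T} \<rho>"
    "\<And>t. t \<in> {0..T} \<Longrightarrow> 0 < \<rho> t"
    "\<And>t. t \<in> {0..T} \<Longrightarrow> x t = \<rho> t ^ p * cos (\<phi> t)" "\<And>t. t \<in> {0..T} \<Longrightarrow> y t = \<rho> t ^ q * sin (\<phi> t)"
    "\<And>t. sin (\<theta> t) = 0 \<Longrightarrow> \<phi> t = \<theta> t"
  proof -
    show ?thesis
      by (rule weighted_polar_lift[OF pq cx cy c\<theta> orbit(1) orbit(5)[folded trig] orbit(6)[folded trig]])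
        (fact that | assumption)+
  qed
  have \<rho>: "\<rho> t < \<epsilon>" if "t \<in> {0..T}" for t
    using weighted_radius_small[OF \<epsilon>, of "\<rho> t" p "\<phi> t" q] orbit(2)[OF that] lift(4,5)[OF that] by simp
  define K where "K t = \<rho> t ^ (p + q) * (real p * (cos (\<phi> t))\<^sup>2 + real q * (sin (\<phi> t))\<^sup>2)" for t
  have K: "0 < K t" if "t \<in> {0..T}" for t
    unfolding K_def using lift(3)[OF that] weighted_square_sum_pos[of "real p" "real q"] pq
    by simp
  let ?A = "\<lambda>t. angular_numerator P Q p q (\<phi> t) (\<rho> t)" and ?R = "\<lambda>t. radial_numerator P Q p q (\<phi> t) (\<rho> t)"
  have d\<phi>: "(\<phi> has_real_derivative \<sigma> * ?A t / K t) (at t within {0..T})"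
    and d\<rho>: "(\<rho> has_real_derivative \<sigma> * ?R t / K t) (at t within {0..T})" if t: "t \<in> {0..T}" for t
    using weighted_polar_derivatives[OF pq t lift(3)[OF t] lift(1,2) lift(4) orbit(3)[OF t]
        lift(5) orbit(4)[OF t]]
    unfolding K_def angular_numerator_def radial_numerator_def lift(4,5)[OF t, symmetric]
    by (auto elim!: DERIV_cong simp: algebra_simps)
  have pos: "0 < \<sigma> * ?A t / K t" if "t \<in> {0..T}" for t
    using sign[OF lift(3) \<rho>] K that by simp
  obtain u where u: "\<phi> 0 < \<phi> T" "\<And>t. t \<in> {0..T} \<Longrightarrow> u (\<phi> t) = \<rho> t" "\<phi> ` {0..T} = {\<phi> 0..\<phi> T}"
    "\<And>t. t \<in> {0..T} \<Longrightarrow> (u has_real_derivative (\<sigma> * ?R t / K t) / (\<sigma> * ?A t / K t)) (at (\<phi> t) within {\<phi> 0..\<phi> T})"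
  proof -
    show ?thesis
      by (rule increasing_reparametrization[OF T d\<phi> pos d\<rho>]) (fact that | assumption)+
  qed
  have "\<theta> T = 2 * pi \<or> \<theta> T = - (2 * pi)" using turn by (auto simp: \<theta>_def abs_if split: if_splits)
  then have "sin (\<theta> T) = 0" by auto
  then have "\<phi> T = \<theta> T" "\<phi> 0 = 0" using lift(6)[of T] lift(6)[of 0] by (auto simp: \<theta>_def)
  then have ends: "\<phi> 0 = 0" "\<phi> T = 2 * pi" using turn u(1) by (auto simp: \<theta>_def)
  have "\<rho> 0 = \<rho>0"
    using lift(4)[of 0] lift(3)[of 0] T init(1) ends \<rho>0 pq by (auto intro: power_eq_imp_eq_base[of _ p])
  then have "u 0 = \<rho>0" using u(2)[of 0] T ends by simp
  moreover have "(s, u s) \<in> cylinder \<epsilon> - (Theta_zeros P Q p q \<epsilon> \<union> base_circle)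
      \<and> (u has_real_derivative polar_F P Q p q s (u s)) (at s within {0..2 * pi})"
    if s: "s \<in> {0..2 * pi}" for s
  proof -
    have "s \<in> \<phi> ` {0..T}" using s unfolding u(3) ends .
    then obtain t where t: "t \<in> {0..T}" "s = \<phi> t" by blast
    have A: "?A t \<noteq> 0" "\<sigma> \<noteq> 0" using pos[OF t(1)] by auto
    have "(s, u s) \<in> cylinder \<epsilon> - (Theta_zeros P Q p q \<epsilon> \<union> base_circle)"
      using A lift(3)[OF t(1)] \<rho>[OF t(1)]
      by (auto simp: cylinder_def Theta_zeros_def base_circle_def t(2) u(2)[OF t(1)] polar_Theta_eq_0_iff[OF pq])
    moreover have "(u has_real_derivative ?R t / ?A t) (at s within {0..2 * pi})"
      using u(4)[OF t(1)] A K[OF t(1)] by (simp add: t(2) ends)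
    ultimately show ?thesis
      using lift(3)[OF t(1)] by (simp add: t(2) u(2)[OF t(1)] polar_F_eq[OF pq])
  qed
  ultimately show ?thesis unfolding polar_solution_def by blast
qed

section \<open>Inverse integrating factors and the Poincare map\<close>

lemma polar_solution_weaken:
  assumes "polar_solution P Q p q \<delta> \<rho>0 u" "\<delta> \<le> \<epsilon>"
  shows "polar_solution P Q p q \<epsilon> \<rho>0 u"
  using assms unfolding polar_solution_def cylinder_def Theta_zeros_def base_circle_def by fastforce

theorem theorem3:
  fixes P Q :: "real ^ 'd \<Rightarrow> real \<Rightarrow> real \<Rightarrow> real"
    and l :: "real ^ 'd"
    and p q :: nat
    and V :: "real \<Rightarrow> real \<Rightarrow> real"
  assumes "analytic_family P" and "analytic_family Q"
    and "l \<in> monodromic_parameters P Q - critical_parameters P Q p q"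
    and "(p, q) \<in> newton_weights (P l) (Q l)"
    and "inverse_integrating_factor (P l) (Q l) p q V"
  shows "(\<exists>\<Psi>. poincare_map (P l) (Q l) p q \<Psi>) \<and>
    (\<forall>\<Psi>. poincare_map (P l) (Q l) p q \<Psi> \<longrightarrow>
      (\<exists>\<epsilon>>0. \<forall>\<rho>0. 0 < \<rho>0 \<and> \<rho>0 < \<epsilon> \<longrightarrow>
         \<Psi> differentiable (at \<rho>0) \<and>
         V 0 (\<Psi> \<rho>0) = V 0 \<rho>0 * deriv \<Psi> \<rho>0))"
proof -
  let ?F = "polar_F (P l) (Q l) p q" and ?A = "angular_numerator (P l) (Q l) p q"
  let ?sol = "polar_solution (P l) (Q l) p q"
  have pq: "0 < p" "0 < q" using assms(4) by (auto simp: newton_weights_def)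
  obtain RP Px Py where RP: "0 < RP" and P:
    "\<And>z. z \<in> ball 0 RP \<Longrightarrow> ((\<lambda>(x, y). P l x y) has_derivative (\<lambda>(h, k). Px z * h + Py z * k)) (at z)"
    "continuous_on (ball 0 RP) Px" "continuous_on (ball 0 RP) Py"
  proof -
    show ?thesis by (rule analytic_family_C1[where l = l, OF assms(1)]) (fact that)
  qed
  obtain RQ Qx Qy where RQ: "0 < RQ" and Q:
    "\<And>z. z \<in> ball 0 RQ \<Longrightarrow> ((\<lambda>(x, y). Q l x y) has_derivative (\<lambda>(h, k). Qx z * h + Qy z * k)) (at z)"
    "continuous_on (ball 0 RQ) Qx" "continuous_on (ball 0 RQ) Qy"
  proof -
    show ?thesis by (rule analytic_family_C1[where l = l, OF assms(2)]) (fact that)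
  qed
  obtain \<delta>\<Theta> where \<delta>\<Theta>: "0 < \<delta>\<Theta>" "Theta_zeros (P l) (Q l) p q \<delta>\<Theta> - base_circle = {}"
    using assms(3) by (auto simp: critical_parameters_def)
  obtain \<delta>V where \<delta>V: "0 < \<delta>V" and V:
    "\<And>\<phi> \<rho>. (\<phi>, \<rho>) \<in> cylinder \<delta>V - (Theta_zeros (P l) (Q l) p q \<delta>V \<union> base_circle) \<Longrightarrow>
      V (\<phi> + 2 * pi) \<rho> = V \<phi> \<rho>"
    "\<And>\<phi> \<rho>. (\<phi>, \<rho>) \<in> cylinder \<delta>V - (Theta_zeros (P l) (Q l) p q \<delta>V \<union> base_circle) \<Longrightarrow>
      (\<lambda>(\<phi>, \<rho>). V \<phi> \<rho>) differentiable (at (\<phi>, \<rho>))"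
    "\<And>\<phi> \<rho>. (\<phi>, \<rho>) \<in> cylinder \<delta>V - (Theta_zeros (P l) (Q l) p q \<delta>V \<union> base_circle) \<Longrightarrow>
      deriv (\<lambda>s. V s \<rho>) \<phi> + deriv (\<lambda>s. V \<phi> s) \<rho> * ?F \<phi> \<rho> = deriv (\<lambda>s. ?F \<phi> s) \<rho> * V \<phi> \<rho>"
    using assms(5) unfolding inverse_integrating_factor_def C1_on_def Let_def differentiable_def
    by fast
  define \<delta> where "\<delta> = Min {1, RP, RQ, \<delta>\<Theta>, \<delta>V}"
  have \<delta>: "0 < \<delta>" "\<delta> \<le> 1" "\<delta> \<le> RP" "\<delta> \<le> RQ" "\<delta> \<le> \<delta>\<Theta>" "\<delta> \<le> \<delta>V"
    using RP RQ \<delta>\<Theta>(1) \<delta>V by (auto simp: \<delta>_def)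
  have "polar_Theta (P l) (Q l) p q \<phi> \<rho> \<noteq> 0" if "0 < \<rho>" "\<rho> < \<delta>" for \<phi> \<rho>
  proof
    assume "polar_Theta (P l) (Q l) p q \<phi> \<rho> = 0"
    then have "(\<phi>, \<rho>) \<in> Theta_zeros (P l) (Q l) p q \<delta>\<Theta> - base_circle"
      using that \<delta>(5) by (auto simp: Theta_zeros_def cylinder_def base_circle_def)
    then show False using \<delta>\<Theta>(2) by simp
  qed
  then have nz: "?A \<phi> \<rho> \<noteq> 0" if "0 < \<rho>" "\<rho> < \<delta>" for \<phi> \<rho>
    using that polar_Theta_eq_0_iff[OF pq] by blast
  have dom: "(\<phi>, \<rho>) \<in> cylinder d - (Theta_zeros (P l) (Q l) p q d \<union> base_circle)"
    if "0 < \<rho>" "\<rho> < \<delta>" "\<rho> < d" for \<phi> \<rho> d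
    using that nz[OF that(1,2)] polar_Theta_eq_0_iff[OF pq that(1)]
    by (auto simp: cylinder_def Theta_zeros_def base_circle_def)

  have ball: "ball 0 \<delta> \<subseteq> ball (0 :: real \<times> real) RP" "ball 0 \<delta> \<subseteq> ball (0 :: real \<times> real) RQ"
    using \<delta> by auto
  note PQ_C1 = pq \<delta>(2) P(1)[OF subsetD[OF ball(1)]] Q(1)[OF subsetD[OF ball(2)]]
    continuous_on_subset[OF P(2) ball(1)] continuous_on_subset[OF P(3) ball(1)]
    continuous_on_subset[OF Q(2) ball(2)] continuous_on_subset[OF Q(3) ball(2)]
  obtain F1 where F1: "\<And>\<phi> \<rho>. \<rho> \<in> {0<..<\<delta>} \<Longrightarrow> (?F \<phi> has_real_derivative F1 \<phi> \<rho>) (at \<rho>)"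
    and cont_F1: "continuous_on (UNIV \<times> {0<..<\<delta>}) (\<lambda>(\<phi>, \<rho>). F1 \<phi> \<rho>)"
    using polar_F_C1[OF PQ_C1 nz] by blast
  interpret scalar_ode ?F F1 "2 * pi" "{0<..<\<delta>}"
    by standard (use F1 cont_F1 in auto)
  have sol: "solution u" if "?sol d \<rho>0 u" "d \<le> \<delta>" for d \<rho>0 u
    using that unfolding polar_solution_def solution_def cylinder_def base_circle_def by fastforce

  \<comment> \<open>the direction of rotation, constant on the connected punctured cylinder\<close>
  obtain \<sigma> where \<sigma>: "\<sigma> = 1 \<or> \<sigma> = - 1"
    "\<And>\<phi> \<rho>. 0 < \<rho> \<Longrightarrow> \<rho> < \<delta> \<Longrightarrow> 0 < \<sigma> * ?A \<phi> \<rho>"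
  proof -
    have "connected (UNIV \<times> {0<..<\<delta>} :: (real \<times> real) set)"
      by (intro convex_connected convex_Times) auto
    then have "(\<forall>z\<in>UNIV \<times> {0<..<\<delta>}. 0 < (\<lambda>(\<phi>, \<rho>). ?A \<phi> \<rho>) z) \<or> (\<forall>z\<in>UNIV \<times> {0<..<\<delta>}. (\<lambda>(\<phi>, \<rho>). ?A \<phi> \<rho>) z < 0)"
      by (rule nonvanishing_constant_sign[OF _ continuous_on_angular_numerator[OF PQ_C1]])
        (use nz in auto)
    then show ?thesis using that[of 1] that[of "- 1"] by auto
  qed

  \<comment> \<open>monodromy provides a solution over a whole turn in every thin cylinder\<close>
  have exists: "\<forall>\<^sub>F \<rho>0 in at_right 0. \<exists>u. ?sol \<epsilon> \<rho>0 u" if \<epsilon>: "0 < \<epsilon>" "\<epsilon> \<le> \<delta>" for \<epsilon>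
  proof -
    have "0 < min (\<epsilon> ^ p) (\<epsilon> ^ q) / 2" using \<epsilon> by simp
    moreover have "monodromic_origin (P l) (Q l)"
      using assms(3) by (simp add: monodromic_parameters_def)
    ultimately obtain d where d: "0 < d" "\<And>z. 0 < norm z \<Longrightarrow> norm z < d \<Longrightarrow>
        full_turn (P l) (Q l) (min (\<epsilon> ^ p) (\<epsilon> ^ q) / 2) z \<and>
        full_turn (\<lambda>x y. - P l x y) (\<lambda>x y. - Q l x y) (min (\<epsilon> ^ p) (\<epsilon> ^ q) / 2) z"
      unfolding monodromic_origin_def by meson
    have "\<exists>u. ?sol \<epsilon> \<rho>0 u" if \<rho>0: "0 < \<rho>0" "\<rho>0 < min 1 d" for \<rho>0
    proof (rule full_turn_imp_polar_solution[OF pq \<rho>0(1) \<epsilon>(1), where \<sigma> = \<sigma>])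
      have "\<rho>0 ^ p \<le> \<rho>0" using power_decreasing[of 1 p \<rho>0] pq \<rho>0 by simp
      then have "0 < norm (\<rho>0 ^ p, 0 :: real)" "norm (\<rho>0 ^ p, 0 :: real) < d"
        using \<rho>0 by (auto simp: norm_Pair)
      from d(2)[OF this]
      show "full_turn (\<lambda>x y. \<sigma> * P l x y) (\<lambda>x y. \<sigma> * Q l x y) (min (\<epsilon> ^ p) (\<epsilon> ^ q) / 2) (\<rho>0 ^ p, 0)"
        using \<sigma>(1) by auto
      show "0 < \<sigma> * ?A \<phi> \<rho>" if "0 < \<rho>" "\<rho> < \<epsilon>" for \<phi> \<rho>
        using \<sigma>(2) that \<epsilon> by auto
    qed
    then show ?thesis
      unfolding eventually_at_right_field using d(1) by (intro exI[of _ "min 1 d"]) auto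
  qed

  \<comment> \<open>one choice of solution in the fixed cylinder serves all thinner ones, by uniqueness\<close>
  define \<Phi> where "\<Phi> \<phi> \<rho>0 = (SOME u. ?sol \<delta> \<rho>0 u) \<phi>" for \<phi> \<rho>0
  have "\<forall>\<^sub>F \<rho>0 in at_right 0. ?sol d \<rho>0 (\<lambda>\<phi>. \<Phi> \<phi> \<rho>0)" if d: "0 < d" for d
  proof -
    have "\<forall>\<^sub>F \<rho>0 in at_right 0. \<exists>u. ?sol (min d \<delta>) \<rho>0 u"
      by (rule exists) (use d \<delta> in auto)
    then show ?thesis
    proof eventually_elim
      fix \<rho>0 assume "\<exists>u. ?sol (min d \<delta>) \<rho>0 u"
      then obtain u where u: "?sol (min d \<delta>) \<rho>0 u" ..
      have "?sol \<delta> \<rho>0 u" by (rule polar_solution_weaken[OF u]) simp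
      then have \<Phi>: "?sol \<delta> \<rho>0 (\<lambda>\<phi>. \<Phi> \<phi> \<rho>0)" unfolding \<Phi>_def by (rule someI[of "?sol \<delta> \<rho>0"])
      have "\<Phi> \<phi> \<rho>0 = u \<phi>" if "\<phi> \<in> {0..2 * pi}" for \<phi>
        using solution_unique[OF sol[OF \<Phi>] sol[OF u]] \<Phi> u that by (auto simp: polar_solution_def)
      then show "?sol d \<rho>0 (\<lambda>\<phi>. \<Phi> \<phi> \<rho>0)"
        using \<Phi> u polar_solution_weaken[OF u, of d] by (simp add: polar_solution_def)
    qed
  qed
  then have "poincare_map (P l) (Q l) p q (\<Phi> (2 * pi))"
    unfolding poincare_map_def by (intro exI[of _ \<Phi>]) auto
  moreover have "\<exists>\<epsilon>>0. \<forall>\<rho>0. 0 < \<rho>0 \<and> \<rho>0 < \<epsilon> \<longrightarrow>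
      \<Psi> differentiable (at \<rho>0) \<and> V 0 (\<Psi> \<rho>0) = V 0 \<rho>0 * deriv \<Psi> \<rho>0"
    if \<Psi>: "poincare_map (P l) (Q l) p q \<Psi>" for \<Psi>
  proof -
    obtain \<Phi> where "\<forall>\<^sub>F \<rho>0 in at_right 0. ?sol \<delta> \<rho>0 (\<lambda>\<phi>. \<Phi> \<phi> \<rho>0)"
      and "\<forall>\<^sub>F \<rho>0 in at_right 0. \<Psi> \<rho>0 = \<Phi> (2 * pi) \<rho>0"
      using \<Psi> \<delta>(1) unfolding poincare_map_def by blast
    then have "\<forall>\<^sub>F \<rho>0 in at_right 0. ?sol \<delta> \<rho>0 (\<lambda>\<phi>. \<Phi> \<phi> \<rho>0) \<and> \<Psi> \<rho>0 = \<Phi> (2 * pi) \<rho>0"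
      by (rule eventually_conj)
    then obtain \<epsilon> where \<epsilon>: "0 < \<epsilon>" and flow: "\<And>\<rho>. \<rho> \<in> {0<..<\<epsilon>} \<Longrightarrow> ?sol \<delta> \<rho> (\<lambda>\<phi>. \<Phi> \<phi> \<rho>)"
      and \<Psi>_eq: "\<And>\<rho>. \<rho> \<in> {0<..<\<epsilon>} \<Longrightarrow> \<Psi> \<rho> = \<Phi> (2 * pi) \<rho>"
      unfolding eventually_at_right_field by auto
    have init: "\<Phi> 0 \<rho> = \<rho>" if "\<rho> \<in> {0<..<\<epsilon>}" for \<rho>
      using flow[OF that] by (simp add: polar_solution_def)
    have "\<Psi> differentiable (at \<rho>) \<and> V 0 (\<Psi> \<rho>) = V 0 \<rho> * deriv \<Psi> \<rho>" if \<rho>: "\<rho> \<in> {0<..<\<epsilon>}" for \<rho>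
    proof -
      let ?m = "exp (integral {0..2 * pi} (\<lambda>\<phi>. F1 \<phi> (\<Phi> \<phi> \<rho>)))"
      have sol_\<rho>: "solution (\<lambda>\<phi>. \<Phi> \<phi> \<rho>)" by (rule sol[OF flow[OF \<rho>]]) simp
      have "(\<Phi> (2 * pi) has_real_derivative ?m) (at \<rho>)"
        by (rule flow_has_derivative[OF sol[OF flow] init _ \<rho>]) auto
      then have \<Psi>': "(\<Psi> has_real_derivative ?m) (at \<rho>)"
        by (rule has_field_derivative_transform_within_open[of _ _ _ "{0<..<\<epsilon>}"])
          (use \<rho> \<Psi>_eq in auto)
      have "V (2 * pi) (\<Phi> (2 * pi) \<rho>) = V 0 (\<Phi> 0 \<rho>) * ?m"
      proof (rule inverse_integrating_factor_along_solution[OF sol_\<rho>])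
        fix \<phi> r :: real assume r: "r \<in> {0<..<\<delta>}"
        then have D: "(\<phi>, r) \<in> cylinder \<delta>V - (Theta_zeros (P l) (Q l) p q \<delta>V \<union> base_circle)"
          using dom[of r \<delta>V \<phi>] \<delta>(6) by auto
        show "(\<lambda>(\<phi>, \<rho>). V \<phi> \<rho>) differentiable (at (\<phi>, r))" by (rule V(2)[OF D])
        show "deriv (\<lambda>s. V s r) \<phi> + deriv (\<lambda>s. V \<phi> s) r * ?F \<phi> r = F1 \<phi> r * V \<phi> r"
          using V(3)[OF D] DERIV_imp_deriv[OF F1[OF r, of \<phi>]] by simp
      qed simp
      moreover have "\<Phi> (2 * pi) \<rho> \<in> {0<..<\<delta>}" using sol_\<rho> by (auto simp: solution_def)
      then have "V (2 * pi) (\<Phi> (2 * pi) \<rho>) = V 0 (\<Phi> (2 * pi) \<rho>)"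
        using V(1)[of 0 "\<Phi> (2 * pi) \<rho>"] dom[of "\<Phi> (2 * pi) \<rho>" \<delta>V 0] \<delta>(6) by auto
      ultimately have "V 0 (\<Psi> \<rho>) = V 0 \<rho> * deriv \<Psi> \<rho>"
        using init[OF \<rho>] \<Psi>_eq[OF \<rho>] DERIV_imp_deriv[OF \<Psi>'] by simp
      then show ?thesis using \<Psi>' real_differentiable_def by blast
    qed
    then show ?thesis using \<epsilon> by (intro exI[of _ \<epsilon>]) auto
  qed
  ultimately show ?thesis by blast
qed

end
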